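(* Let $N$ be a Sol-manifold which is a torus bundle over $S^1$. Then $\pi_1(N)$ does not have a finite index subgroup which is residually $p$ for all primes $p$.
   Context: A (closed orientable) Sol-manifold which is a torus bundle over $S^1$ is a closed orientable $3$-manifold that is a torus bundle over $S^1$ such that the eigenvalues of the monodromy $H_1(T;\mathbb{Z})\to H_1(T;\mathbb{Z})$ on the first homology of the fiber torus $T$ are of the form $\{e^{-t},e^{t}\}$ for some real $t>0$; in this case $\pi_1(N)\cong\mathbb{Z}\ltimes_\varphi\mathbb{Z}^2$, where $1\in\mathbb{Z}$ acts on $\mathbb{Z}^2$ by an automorphism $\varphi$ with eigenvalues $\{e^{-t},e^t\}$. A $p$-group is a finite group of order a power of the prime $p$. A group $G$ is residually $p$ if for every $g\in G$ with $g\ne 1$ there is a homomorphism $\alpha\colon G\to P$ to a $p$-group $P$ with $\alpha(g)\neq 1$. *)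

theory Defs
  imports "HOL-Analysis.Analysis" "HOL-Homology.Homology" "HOL-Computational_Algebra.Primes"
begin

section \<open>The fundamental group\<close>

definition loops :: "'a::topological_space set \<Rightarrow> 'a \<Rightarrow> (real \<Rightarrow> 'a) set" where
  "loops S x0 = {g. path g \<and> path_image g \<subseteq> S \<and> pathstart g = x0 \<and> pathfinish g = x0}"

definition loop_class :: "'a::topological_space set \<Rightarrow> (real \<Rightarrow> 'a) \<Rightarrow> (real \<Rightarrow> 'a) set" where
  "loop_class S g = {h. homotopic_paths S g h}"

text \<open>The product is a union over all representatives; all of them give the same class, see
  \<open>fundamental_group_mult\<close>.\<close>

definition fundamental_group :: "'a::topological_space set \<Rightarrow> 'a \<Rightarrow> (real \<Rightarrow> 'a) set monoid" where
  "fundamental_group S x0 =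
     \<lparr>carrier = loop_class S ` loops S x0,
      monoid.mult = (\<lambda>C D. \<Union>g\<in>C. \<Union>h\<in>D. loop_class S (g +++ h)),
      one = loop_class S (\<lambda>_. x0)\<rparr>"

lemma loop_class_eq_iff:
  assumes "g \<in> loops S x0"
  shows "loop_class S g = loop_class S h \<longleftrightarrow> homotopic_paths S g h"
proof
  have "g \<in> loop_class S g"
    using assms by (simp add: loop_class_def loops_def)
  then show "loop_class S g = loop_class S h \<Longrightarrow> homotopic_paths S g h"
    by (simp add: loop_class_def homotopic_paths_sym_eq)
  show "homotopic_paths S g h \<Longrightarrow> loop_class S g = loop_class S h"
    unfolding loop_class_def by (auto intro: homotopic_paths_trans homotopic_paths_sym)
qed

lemma fundamental_group_mult:
  assumes g: "g \<in> loops S x0" and h: "h \<in> loops S x0"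
  shows "loop_class S g \<otimes>\<^bsub>fundamental_group S x0\<^esub> loop_class S h = loop_class S (g +++ h)"
proof -
  have gh: "g +++ h \<in> loops S x0"
    using g h by (auto simp: loops_def path_image_join)
  have "loop_class S (g' +++ h') = loop_class S (g +++ h)"
    if "g' \<in> loop_class S g" "h' \<in> loop_class S h" for g' h'
  proof -
    have "homotopic_paths S (g +++ h) (g' +++ h')"
      using that g h by (intro homotopic_paths_join) (auto simp: loop_class_def loops_def)
    then show ?thesis
      using loop_class_eq_iff[OF gh] by metis
  qed
  then have "(\<Union>g'\<in>loop_class S g. \<Union>h'\<in>loop_class S h. loop_class S (g' +++ h')) =
             (\<Union>g'\<in>loop_class S g. \<Union>h'\<in>loop_class S h. loop_class S (g +++ h))"
    by (intro SUP_cong refl)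
  moreover have "g \<in> loop_class S g" "h \<in> loop_class S h"
    using g h by (simp_all add: loop_class_def loops_def)
  then have "loop_class S g \<noteq> {}" "loop_class S h \<noteq> {}"
    by auto
  ultimately show ?thesis
    by (simp only: fundamental_group_def monoid.simps UN_constant if_False)
qed


section \<open>Residually p groups\<close>

definition p_group :: "nat \<Rightarrow> ('a, 'b) monoid_scheme \<Rightarrow> bool" where
  "p_group p P \<longleftrightarrow> group P \<and> finite (carrier P) \<and> (\<exists>k. order P = p ^ k)"

text \<open>A quantifier inside a formula cannot range over types. Every finite group is isomorphic to one
  whose elements are natural numbers, so \<^typ>\<open>nat monoid\<close> covers all target groups; see
  \<open>residually_pI\<close>.\<close>

definition residually_p :: "nat \<Rightarrow> ('a, 'b) monoid_scheme \<Rightarrow> bool" where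
  "residually_p p G \<longleftrightarrow>
     (\<forall>g\<in>carrier G. g \<noteq> \<one>\<^bsub>G\<^esub> \<longrightarrow>
        (\<exists>(P :: nat monoid) \<alpha>. p_group p P \<and> \<alpha> \<in> hom G P \<and> \<alpha> g \<noteq> \<one>\<^bsub>P\<^esub>))"

lemma p_group_nat_copy:
  fixes Q :: "('c, 'd) monoid_scheme"
  assumes "p_group p Q"
  shows "\<exists>(P :: nat monoid) \<phi>. p_group p P \<and> \<phi> \<in> iso Q P \<and> \<phi> \<one>\<^bsub>Q\<^esub> = \<one>\<^bsub>P\<^esub>"
proof -
  interpret Q: group Q using assms by (simp add: p_group_def)
  obtain \<phi> :: "'c \<Rightarrow> nat" where inj: "inj_on \<phi> (carrier Q)"
    using assms finite_imp_inj_to_nat_seg unfolding p_group_def by metis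
  define \<psi> where "\<psi> = inv_into (carrier Q) \<phi>"
  define P :: "nat monoid" where
    "P = \<lparr>carrier = \<phi> ` carrier Q, monoid.mult = (\<lambda>x y. \<phi> (\<psi> x \<otimes>\<^bsub>Q\<^esub> \<psi> y)), one = \<phi> \<one>\<^bsub>Q\<^esub>\<rparr>"
  have \<psi>: "\<psi> (\<phi> x) = x" if "x \<in> carrier Q" for x
    using that inj by (simp add: \<psi>_def)
  have "group P"
  proof (rule groupI)
    fix x assume "x \<in> carrier P"
    then obtain a where a: "a \<in> carrier Q" "x = \<phi> a" by (auto simp: P_def)
    then show "\<exists>y\<in>carrier P. y \<otimes>\<^bsub>P\<^esub> x = \<one>\<^bsub>P\<^esub>"
      by (intro bexI[of _ "\<phi> (inv\<^bsub>Q\<^esub> a)"]) (auto simp: P_def \<psi>)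
  qed (auto simp: P_def \<psi> Q.m_assoc)
  moreover have "finite (carrier P)" "order P = order Q"
    using assms inj by (auto simp: P_def p_group_def order_def card_image)
  ultimately have "p_group p P"
    using assms by (simp add: p_group_def)
  moreover have "\<phi> \<in> iso Q P"
    using inj by (auto simp: iso_def hom_def bij_betw_def P_def \<psi>)
  moreover have "\<phi> \<one>\<^bsub>Q\<^esub> = \<one>\<^bsub>P\<^esub>"
    by (simp add: P_def)
  ultimately show ?thesis
    by blast
qed

lemma residually_pI:
  fixes G :: "('a, 'b) monoid_scheme" and Q :: "'a \<Rightarrow> ('c, 'd) monoid_scheme"
  assumes "group G"
    and "\<And>g. \<lbrakk>g \<in> carrier G; g \<noteq> \<one>\<^bsub>G\<^esub>\<rbrakk> \<Longrightarrow>
           p_group p (Q g) \<and> (\<exists>\<alpha>. \<alpha> \<in> hom G (Q g) \<and> \<alpha> g \<noteq> \<one>\<^bsub>Q g\<^esub>)"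
  shows "residually_p p G"
  unfolding residually_p_def
proof (intro ballI impI)
  fix g assume g: "g \<in> carrier G" "g \<noteq> \<one>\<^bsub>G\<^esub>"
  then obtain \<alpha> where Q: "p_group p (Q g)" and \<alpha>: "\<alpha> \<in> hom G (Q g)" "\<alpha> g \<noteq> \<one>\<^bsub>Q g\<^esub>"
    using assms(2) by blast
  obtain P :: "nat monoid" and \<phi> where P: "p_group p P" "\<phi> \<in> iso (Q g) P" "\<phi> \<one>\<^bsub>Q g\<^esub> = \<one>\<^bsub>P\<^esub>"
    using p_group_nat_copy[OF Q] by blast
  have "\<alpha> g \<in> carrier (Q g)" "\<one>\<^bsub>Q g\<^esub> \<in> carrier (Q g)"
    using \<alpha> g Q by (auto simp: hom_def p_group_def group.is_monoid monoid.one_closed)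
  then have "\<phi> (\<alpha> g) \<noteq> \<one>\<^bsub>P\<^esub>"
    using P \<alpha> unfolding iso_def bij_betw_def inj_on_def by force
  moreover have "\<phi> \<circ> \<alpha> \<in> hom G P"
    using P(2) \<alpha>(1) by (intro hom_compose) (auto simp: iso_def)
  ultimately show "\<exists>(P :: nat monoid) \<alpha>. p_group p P \<and> \<alpha> \<in> hom G P \<and> \<alpha> g \<noteq> \<one>\<^bsub>P\<^esub>"
    using P(1) by (intro exI[of _ P] exI[of _ "\<phi> \<circ> \<alpha>"]) auto
qed


section \<open>Closed orientable manifolds\<close>

definition closed_manifold :: "nat \<Rightarrow> 'a topology \<Rightarrow> bool" where
  "closed_manifold n X \<longleftrightarrow>
     compact_space X \<and> Hausdorff_space X \<and> second_countable X \<and>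
     (\<forall>x\<in>topspace X. \<exists>U. openin X U \<and> x \<in> U \<and>
        subtopology X U homeomorphic_space Euclidean_space n)"

text \<open>A locally consistent choice \<open>\<mu>\<close> of generators of the local homology groups
  \<open>H\<^sub>n(X, X - {x})\<close>.\<close>

definition orientable :: "nat \<Rightarrow> 'a topology \<Rightarrow> bool" where
  "orientable n X \<longleftrightarrow>
     (\<exists>\<mu>. (\<forall>x\<in>topspace X.
              \<mu> x \<in> carrier (relative_homology_group (int n) X (topspace X - {x})) \<and>
              generate (relative_homology_group (int n) X (topspace X - {x})) {\<mu> x}
                = carrier (relative_homology_group (int n) X (topspace X - {x}))) \<and>
          (\<forall>x\<in>topspace X. \<exists>B c. openin X B \<and> x \<in> B \<and>
              c \<in> carrier (relative_homology_group (int n) X (topspace X - B)) \<and>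
              (\<forall>y\<in>B. hom_induced (int n) X (topspace X - B) X (topspace X - {y}) id c = \<mu> y)))"


section \<open>Fibre bundles over the circle\<close>

abbreviation circle :: "complex set" where
  "circle \<equiv> sphere 0 1"

abbreviation torus :: "(complex \<times> complex) set" where
  "torus \<equiv> circle \<times> circle"

definition fibre_bundle ::
    "'a::topological_space set \<Rightarrow> ('a \<Rightarrow> 'b::topological_space) \<Rightarrow> 'b set
       \<Rightarrow> 'c::topological_space set \<Rightarrow> bool" where
  "fibre_bundle E p B F \<longleftrightarrow>
     continuous_on E p \<and> p ` E = B \<and>
     (\<forall>b\<in>B. \<exists>U h k. openin (top_of_set B) U \<and> b \<in> U \<and>
        homeomorphism (E \<inter> p -` U) (U \<times> F) h k \<and>
        (\<forall>x\<in>E \<inter> p -` U. fst (h x) = p x))"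

text \<open>Here \<open>\<Phi>\<close> trivialises the pullback of the bundle along \<open>[0,1] \<rightarrow> S\<^sup>1\<close>, \<open>s \<mapsto> e\<^bsup>2\<pi>is\<^esup>\<close>, and the
  monodromy is \<open>\<Phi>\<^sub>0\<^sup>-\<^sup>1 \<circ> \<Phi>\<^sub>1\<close>: parallel transport once around the circle, the fibre over \<open>1\<close> being
  identified with \<open>F\<close> by \<open>\<Phi>\<^sub>0\<close>. It is determined up to isotopy and conjugation.\<close>

definition is_monodromy ::
    "'a::topological_space set \<Rightarrow> ('a \<Rightarrow> complex) \<Rightarrow> 'c::topological_space set \<Rightarrow> ('c \<Rightarrow> 'c) \<Rightarrow> bool" where
  "is_monodromy E p F f \<longleftrightarrow>
     (\<exists>\<Phi> :: 'c \<times> real \<Rightarrow> 'a.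
        continuous_on (F \<times> {0..1}) \<Phi> \<and>
        (\<forall>s\<in>{0..1}. \<exists>k. homeomorphism F (E \<inter> p -` {cis (2 * pi * s)}) (\<lambda>x. \<Phi> (x, s)) k) \<and>
        f \<in> F \<rightarrow> F \<and> (\<forall>x\<in>F. \<Phi> (f x, 0) = \<Phi> (x, 1)))"


section \<open>Eigenvalues of an endomorphism of a free abelian group\<close>

definition is_Z_basis :: "('g, 'b) monoid_scheme \<Rightarrow> ('n::finite \<Rightarrow> 'g) \<Rightarrow> bool" where
  "is_Z_basis G e \<longleftrightarrow>
     range e \<subseteq> carrier G \<and>
     bij_betw (\<lambda>m :: int ^ 'n. \<Otimes>\<^bsub>G\<^esub>i\<in>UNIV. e i [^]\<^bsub>G\<^esub> (m $ i)) UNIV (carrier G)"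

definition represents ::
    "('g, 'b) monoid_scheme \<Rightarrow> ('n::finite \<Rightarrow> 'g) \<Rightarrow> ('g \<Rightarrow> 'g) \<Rightarrow> int ^ 'n ^ 'n \<Rightarrow> bool" where
  "represents G e \<phi> A \<longleftrightarrow>
     (\<forall>j. \<phi> (e j) = (\<Otimes>\<^bsub>G\<^esub>i\<in>UNIV. e i [^]\<^bsub>G\<^esub> (A $ i $ j)))"

definition eigenvalues :: "int ^ 'n ^ 'n \<Rightarrow> complex set" where
  "eigenvalues A = {c. \<exists>v. v \<noteq> 0 \<and> map_matrix of_int A *v v = c *s v}"


section \<open>Sol-manifolds which are torus bundles\<close>

text \<open>The cardinality of the index type \<^typ>\<open>2\<close> is the rank of
  \<open>H\<^sub>1(T;\<int>)\<close>; the eigenvalues do not depend on the choice of the basis \<open>e\<close>.\<close>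

definition sol_torus_bundle :: "'a::topological_space set \<Rightarrow> bool" where
  "sol_torus_bundle N \<longleftrightarrow>
     closed_manifold 3 (top_of_set N) \<and> orientable 3 (top_of_set N) \<and>
     (\<exists>p f. fibre_bundle N p circle torus \<and> is_monodromy N p torus f \<and>
        (\<exists>(e :: 2 \<Rightarrow> (complex \<times> complex) chain set) A (t::real).
           is_Z_basis (homology_group 1 (top_of_set torus)) e \<and>
           represents (homology_group 1 (top_of_set torus)) e
             (hom_induced 1 (top_of_set torus) {} (top_of_set torus) {} f) A \<and>
           t > 0 \<and>
           eigenvalues A = {complex_of_real (exp (- t)), complex_of_real (exp t)}))"

end

theory Submission
  imports Defs "HOL-Complex_Analysis.Complex_Analysis"
begin

text \<open>The bundle gives two elements \<open>a\<close> and \<open>s\<close> of the fundamental group: \<open>a\<close> runs around a loop in the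
  fibre, and \<open>s\<close> crosses every fibre once. Conjugation by \<open>s\<close> acts on the fibre loops as the monodromy,
  whose characteristic polynomial is \<open>X\<^sup>2 - n X + 1\<close> with \<open>n = e\<^sup>t + e\<^bsup>-t\<^esup> > 2\<close>. Writing \<open>b\<close> and \<open>c\<close> for the
  first two conjugates of \<open>a\<close>, this says that \<open>a\<close> and \<open>b\<close> commute and \<open>c a = b\<^sup>n\<close>; moreover \<open>a\<close> has
  infinite order. These relations alone exclude a finite index subgroup \<open>H\<close> which is residually \<open>p\<close>
  for all \<open>p\<close>.

  For the group theory (\<open>not_residually_p_of_hyperbolic_conjugation\<close>), let \<open>\<tau>\<^sub>N\<close> be the trace of the
  \<open>N\<close>-th power of the monodromy, so that the action of \<open>s\<^sup>N\<close> on the span of \<open>a\<close> and \<open>b\<close> is a root of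
  \<open>X\<^sup>2 - \<tau>\<^sub>N X + 1\<close>. Choose \<open>m\<close> and \<open>k\<close> positive with \<open>a\<^sup>m\<close> and \<open>s\<^sup>k\<close> in \<open>H\<close>, and an odd prime \<open>p\<close> dividing
  \<open>\<tau>\<^bsub>2k\<^esub>\<close>, which exists because \<open>\<tau>\<^bsub>2k\<^esub> = \<tau>\<^sub>k\<^sup>2 - 2\<close> is greater than 2 and not divisible by 4. In a
  quotient of \<open>H\<close> of order \<open>p\<^sup>j\<close> the element \<open>s\<^sup>N\<close> with \<open>N = 2 k p\<^sup>j\<close> becomes trivial, so its action does
  too, and the image \<open>z\<close> of \<open>a\<^sup>m\<close> satisfies \<open>z\<^sup>2 = z\<^bsup>\<tau>\<^esup>\<close> with \<open>\<tau> = \<tau>\<^sub>N\<close>. But \<open>p\<close> divides \<open>\<tau>\<^sub>N\<close>, as \<open>p\<^sup>j\<close>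
  is odd, hence not \<open>\<tau>\<^sub>N - 2\<close>; as the order of \<open>z\<close> is a power of \<open>p\<close>, this forces \<open>z = 1\<close>. So the
  nontrivial element \<open>a\<^sup>m\<close> dies in every \<open>p\<close>-quotient of \<open>H\<close>.

  The topology has to produce the relations. Loops in the torus are classified up to homotopy by the
  winding numbers of their two components. Winding numbers extend to singular 1-chains and vanish on
  boundaries, so they are functions of the homology class; the Cayley--Hamilton theorem for the
  monodromy on homology then becomes a linear recurrence between the winding numbers of \<open>g\<close>, \<open>f \<circ> g\<close> and
  \<open>f \<circ> f \<circ> g\<close> (\<open>torus_winding_recurrence\<close>). Sweeping a fibre loop once around the circle gives a
  square which exhibits conjugation by \<open>s\<close> as the monodromy (\<open>monodromy_conjugation\<close>). Finally \<open>a\<close> has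
  infinite order because the fibre is \<open>\<pi>\<^sub>1\<close>-injective: a null homotopy in the total space lifts to the
  infinite cyclic cover, which is the product of the fibre with a line
  (\<open>fibre_loop_null_homotopic\<close>).\<close>

section \<open>Traces of powers of a hyperbolic matrix\<close>

text \<open>The trace of the \<open>n\<close>-th power of a 2 by 2 matrix of determinant 1 and trace \<open>u\<close>.\<close>

fun lucas_trace :: "int \<Rightarrow> nat \<Rightarrow> int" where
  "lucas_trace u 0 = 2"
| "lucas_trace u (Suc 0) = u"
| "lucas_trace u (Suc (Suc n)) = u * lucas_trace u (Suc n) - lucas_trace u n"

text \<open>For an eigenvalue \<open>\<lambda>\<close> this is \<open>\<lambda>\<^bsup>m+k\<^esup> + \<lambda>\<^bsup>m-k\<^esup> = (\<lambda>\<^sup>k + \<lambda>\<^bsup>-k\<^esup>) \<lambda>\<^sup>m\<close>. Stated for sequences, it avoids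
  matrices: for \<open>k = m\<close> it is the Cayley--Hamilton theorem for the \<open>m\<close>-th power.\<close>

lemma recurrence_symmetric_sum:
  fixes w :: "nat \<Rightarrow> int"
  assumes w: "\<And>i. w (Suc (Suc i)) = u * w (Suc i) - w i" and "k \<le> m"
  shows "w (m + k) + w (m - k) = lucas_trace u k * w m"
  using w \<open>k \<le> m\<close>
proof (induction u k rule: lucas_trace.induct)
  case (2 u)
  then obtain j where "m = Suc j" by (cases m) auto
  then show ?case using 2(1)[of j] by simp
next
  case (3 u n)
  have 1: "w (m + Suc n) + w (m - Suc n) = lucas_trace u (Suc n) * w m"
    using 3 by simp
  have 2: "w (m + n) + w (m - n) = lucas_trace u n * w m"
    using 3 by simp
  obtain j where j: "m = j + n + 2"
    using 3(4) by (metis add.assoc add.commute add_2_eq_Suc' le_Suc_ex)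
  have "w (m + Suc (Suc n)) = u * w (m + Suc n) - w (m + n)"
    using 3(3)[of "m + n"] by simp
  moreover have "w (m - n) = u * w (m - Suc n) - w (m - Suc (Suc n))"
    using 3(3)[of j] j by (simp add: numeral_2_eq_2)
  ultimately have "w (m + Suc (Suc n)) + w (m - Suc (Suc n))
      = u * (w (m + Suc n) + w (m - Suc n)) - (w (m + n) + w (m - n))"
    by (simp add: algebra_simps)
  also have "\<dots> = lucas_trace u (Suc (Suc n)) * w m"
    unfolding 1 2 by (simp add: algebra_simps)
  finally show ?case .
qed simp

lemma recurrence_subsequence:
  fixes w :: "nat \<Rightarrow> int"
  assumes w: "\<And>i. w (Suc (Suc i)) = u * w (Suc i) - w i"
  shows "w (K * Suc (Suc i)) = lucas_trace u K * w (K * Suc i) - w (K * i)"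
  using recurrence_symmetric_sum[of w u K "K * Suc i", OF w] by (simp add: algebra_simps)

lemma lucas_trace_double: "lucas_trace u (2 * k) = (lucas_trace u k)\<^sup>2 - 2"
  using recurrence_symmetric_sum[of "lucas_trace u" u k k]
  by (simp add: power2_eq_square mult_2)

lemma lucas_trace_gt_2:
  assumes "u > 2" "k > 0"
  shows "lucas_trace u k > 2"
proof -
  have "lucas_trace u k \<ge> 2 \<and> lucas_trace u (Suc k) > lucas_trace u k" for k
  proof (induction k)
    case (Suc k)
    have "lucas_trace u (Suc (Suc k)) = (u - 1) * lucas_trace u (Suc k) + (lucas_trace u (Suc k) - lucas_trace u k)"
      by (simp add: algebra_simps)
    moreover have "(u - 1) * lucas_trace u (Suc k) \<ge> 1 * lucas_trace u (Suc k)"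
      using assms Suc by (intro mult_right_mono) auto
    ultimately have "lucas_trace u (Suc (Suc k)) > lucas_trace u (Suc k)"
      using Suc by linarith
    then show ?case using Suc by auto
  qed (use assms in auto)
  from this[of "k - 1"] show ?thesis using assms by (cases k) auto
qed

text \<open>Modulo a divisor of \<open>u\<close> the recurrence reads \<open>\<tau>\<^bsub>n+2\<^esub> = - \<tau>\<^sub>n\<close>, and \<open>\<tau>\<^sub>1\<close> is 0.\<close>

lemma dvd_lucas_trace_odd:
  assumes "p dvd u" "odd n"
  shows "p dvd lucas_trace u n"
  using assms by (induction u n rule: lucas_trace.induct) auto

text \<open>The double index serves to make the trace of the form \<open>t\<^sup>2 - 2\<close>, which is never divisible by 4; an
  undoubled trace can be a power of 2.\<close>

lemma odd_prime_dvd_lucas_trace: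
  assumes "u > 2" "k > 0"
  obtains p :: nat where "prime p" "odd p" "int p dvd lucas_trace u (2 * k)"
proof -
  define t where "t = lucas_trace u k"
  have t: "t > 2" using lucas_trace_gt_2[OF assms] by (simp add: t_def)
  then have "t * t \<ge> 3 * 3" by (intro mult_mono) auto
  then have t2: "t\<^sup>2 - 2 > 2" by (simp add: power2_eq_square)
  define q where "q = (if odd t then t\<^sup>2 - 2 else (t\<^sup>2 - 2) div 2)"
  have q: "odd q \<and> q > 1 \<and> q dvd t\<^sup>2 - 2"
  proof (cases "odd t")
    case False
    then obtain r where r: "t = 2 * r" by auto
    then have eq: "t\<^sup>2 - 2 = 2 * (2 * r\<^sup>2 - 1)"
      by (simp add: power2_eq_square)
    then have q: "q = 2 * r\<^sup>2 - 1" using False by (simp add: q_def)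
    then have "t\<^sup>2 - 2 = q * 2" using eq by simp
    then have "q dvd t\<^sup>2 - 2" by (rule dvdI)
    then show ?thesis using t2 q eq by simp
  qed (use t2 in \<open>auto simp: q_def\<close>)
  then have "nat q \<noteq> 1" by auto
  then obtain p where p: "prime p" "p dvd nat q"
    using prime_factor_nat by blast
  then have "int p dvd q" using q by (simp add: int_dvd_int_iff[symmetric])
  show ?thesis
  proof (rule that)
    show "odd p" using \<open>int p dvd q\<close> q dvd_trans[of 2 "int p" q] by auto
    show "int p dvd lucas_trace u (2 * k)"
      using \<open>int p dvd q\<close> q dvd_trans[of "int p" q] by (auto simp: lucas_trace_double t_def)
  qed fact
qed

lemma lucas_trace_mult: "lucas_trace u (K * i) = lucas_trace (lucas_trace u K) i"
proof (induction "lucas_trace u K" i rule: lucas_trace.induct)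
  case (3 n)
  then show ?case
    using recurrence_subsequence[of "lucas_trace u" u K n] by simp
qed auto

section \<open>Groups with a hyperbolic conjugation\<close>

text \<open>Two of the cosets \<open>H x\<^sup>i\<close> coincide.\<close>

lemma (in group) finite_index_pow_mem:
  assumes H: "subgroup H G" "finite (rcosets H)" and x: "x \<in> carrier G"
  obtains m :: nat where "m > 0" "x [^] m \<in> H"
proof -
  have "finite ((\<lambda>i::nat. H #> (x [^] i)) ` UNIV)"
    using H x by (intro finite_subset[OF _ H(2)]) (auto intro!: rcosetsI subgroup.subset)
  then obtain i j :: nat where ij: "i < j" "H #> (x [^] i) = H #> (x [^] j)"
    by (metis (mono_tags, lifting) finite_imageD infinite_UNIV_nat inj_onI linorder_neqE_nat)
  have "x [^] j \<in> H #> (x [^] i)"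
    using ij rcos_self[of "x [^] j" H] H x by simp
  then obtain h where h: "h \<in> H" "x [^] j = h \<otimes> x [^] i"
    by (auto simp: r_coset_def)
  have "x [^] j = x [^] (j - i) \<otimes> x [^] i"
    using ij x by (simp add: nat_pow_mult)
  then have "h = x [^] (j - i)"
    using h x subgroup.mem_carrier[OF H(1)] by (metis nat_pow_closed right_cancel)
  then show ?thesis using that[of "j - i"] ij h by auto
qed

lemma (in group) int_pow_intertwine:
  assumes "s \<in> carrier G" "x \<in> carrier G" "y \<in> carrier G" "x \<otimes> s = s \<otimes> y"
  shows "x [^] (k::int) \<otimes> s = s \<otimes> y [^] k"
proof -
  have cancel: "s \<otimes> (inv s \<otimes> z) = z" if "z \<in> carrier G" for z
    using that assms by (simp add: m_assoc[symmetric])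
  have y: "y = inv s \<otimes> x \<otimes> s"
    using assms by (metis inv_closed inv_solve_left m_assoc m_closed)
  have "(\<lambda>z. inv s \<otimes> z \<otimes> s) \<in> hom G G"
    using assms by (auto simp: hom_def m_assoc cancel)
  from hom_int_pow[OF this assms(2) group_axioms, of k]
  have "y [^] k = inv s \<otimes> x [^] k \<otimes> s"
    by (simp add: y)
  then show ?thesis
    using assms by (simp add: m_assoc cancel)
qed

lemma (in group) pow_eq_one_of_coprime:
  assumes "x \<in> carrier G" "x [^] (m::int) = \<one>" "x [^] (n::int) = \<one>" "coprime m n"
  shows "x = \<one>"
proof -
  obtain u v where uv: "u * m + v * n = 1"
    using assms(4) bezout_int[of m n] by auto
  have "x = x [^] (u * m + v * n)" using assms by (simp add: uv int_pow_1)
  also have "\<dots> = (x [^] m) [^] u \<otimes> (x [^] n) [^] v"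
    using assms(1) by (simp add: int_pow_mult int_pow_pow mult.commute)
  finally show ?thesis using assms by (simp)
qed

text \<open>Of the subgroup \<open>H\<close>, only a power of \<open>a\<close> and a power of \<open>s\<close> enter the proof, together with the
  conjugates of that power of \<open>a\<close>. The span of \<open>a\<close> and \<open>b\<close> is parametrised by pairs of integers through
  \<open>e\<close>, so that conjugation by \<open>s\<close> becomes the linear map \<open>T\<close> and the relations between conjugates follow
  from the scalar recurrence of the coordinates of \<open>v\<close>.\<close>

proposition (in group) not_residually_p_of_hyperbolic_conjugation:
  fixes n :: nat
  assumes H: "subgroup H G" "finite (rcosets H)"
    and carr: "a \<in> carrier G" "b \<in> carrier G" "c \<in> carrier G" "s \<in> carrier G"
    and ab: "a \<otimes> b = b \<otimes> a"
    and as: "a \<otimes> s = s \<otimes> b" and bs: "b \<otimes> s = s \<otimes> c"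
    and ca: "c \<otimes> a = b [^] n" and n: "n > 2"
    and inf: "\<And>k::nat. k > 0 \<Longrightarrow> a [^] k \<noteq> \<one>"
  shows "\<exists>p. prime p \<and> \<not> residually_p p (G\<lparr>carrier := H\<rparr>)"
proof -
  define u where "u = int n"
  define e where "e = (\<lambda>v::int \<times> int. a [^] fst v \<otimes> b [^] snd v)"
  \<comment> \<open>The companion matrix of the polynomial that the conjugation satisfies.\<close>
  define T where "T = (\<lambda>v::int \<times> int. (- snd v, fst v + u * snd v))"
  have e_carr: "e v \<in> carrier G" for v
    using carr by (simp add: e_def)
  have "a [^] i \<otimes> b = b \<otimes> a [^] i" for i :: int
    using int_pow_intertwine[of b a a i] carr ab by simp
  then have comm: "b [^] j \<otimes> a [^] i = a [^] i \<otimes> b [^] j" for i j :: int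
    using int_pow_intertwine[of "a [^] i" b b j] carr by simp
  have e_add: "e v \<otimes> e w = e (v + w)" for v w
  proof -
    have "e v \<otimes> e w = a [^] fst v \<otimes> (b [^] snd v \<otimes> a [^] fst w) \<otimes> b [^] snd w"
      using carr by (simp add: e_def m_assoc)
    also have "\<dots> = (a [^] fst v \<otimes> a [^] fst w) \<otimes> (b [^] snd v \<otimes> b [^] snd w)"
      unfolding comm using carr by (simp add: m_assoc)
    finally show ?thesis using carr by (simp add: e_def int_pow_mult)
  qed
  have e_pow: "e v [^] k = e (k * fst v, k * snd v)" for v and k :: int
  proof -
    have "e v [^] k = (a [^] fst v) [^] k \<otimes> (b [^] snd v) [^] k"
      unfolding e_def using carr comm by (intro int_pow_mult_distrib) auto
    then show ?thesis
      using carr by (simp add: e_def int_pow_pow mult.commute)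
  qed
  have c: "c = e (-1, u)"
  proof -
    have "c = b [^] u \<otimes> inv a"
      using ca carr by (simp add: u_def int_pow_int inv_solve_right)
    then show ?thesis
      using carr comm[of u "-1"] by (simp add: e_def int_pow_neg int_pow_1)
  qed
  have e_T: "e v \<otimes> s = s \<otimes> e (T v)" for v
  proof -
    have "e v \<otimes> s = a [^] fst v \<otimes> s \<otimes> c [^] snd v"
      using int_pow_intertwine[OF _ _ _ bs, of "snd v"] carr by (simp add: e_def m_assoc)
    also have "\<dots> = s \<otimes> (b [^] fst v \<otimes> c [^] snd v)"
      using int_pow_intertwine[OF _ _ _ as, of "fst v"] carr by (simp add: m_assoc)
    also have "b [^] fst v \<otimes> c [^] snd v = e (0, fst v) \<otimes> e (- snd v, u * snd v)"
      using carr unfolding c e_pow by (simp add: e_def mult.commute)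
    also have "\<dots> = e (T v)"
      unfolding e_add by (simp add: T_def)
    finally show ?thesis .
  qed
  obtain m :: nat where m: "m > 0" "a [^] m \<in> H"
    using finite_index_pow_mem[OF H carr(1)] .
  obtain k :: nat where k: "k > 0" "s [^] k \<in> H"
    using finite_index_pow_mem[OF H carr(4)] .
  define v where "v = (\<lambda>i. (T ^^ i) (int m, 0))"
  have v0: "e (v 0) = a [^] m"
    using carr by (simp add: v_def e_def int_pow_int)
  have v_conj: "e (v 0) \<otimes> s [^] N = s [^] N \<otimes> e (v N)" for N :: nat
  proof (induction N)
    case (Suc N)
    have "e (v 0) \<otimes> s [^] Suc N = s [^] N \<otimes> (e (v N) \<otimes> s)"
      using Suc carr e_carr by (simp add: m_assoc[symmetric])
    also have "\<dots> = s [^] Suc N \<otimes> e (v (Suc N))"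
      using carr e_carr by (simp add: e_T m_assoc v_def)
    finally show ?case .
  qed (use carr e_carr in simp)
  have v_sum: "e (v (2 * N)) \<otimes> e (v 0) = e (v N) [^] lucas_trace u N" for N
  proof -
    have "fst (v (N + N)) + fst (v (N - N)) = lucas_trace u N * fst (v N)"
      by (rule recurrence_symmetric_sum) (auto simp: v_def T_def)
    moreover have "snd (v (N + N)) + snd (v (N - N)) = lucas_trace u N * snd (v N)"
      by (rule recurrence_symmetric_sum) (auto simp: v_def T_def)
    ultimately show ?thesis
      unfolding e_add e_pow by (simp add: mult_2 plus_prod_def)
  qed
  \<comment> \<open>The prime depends only on \<open>k\<close>, so that it is fixed before any quotient of \<open>H\<close> is chosen.\<close>
  obtain p where p: "prime p" "odd p" "int p dvd lucas_trace u (2 * k)"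
    using odd_prime_dvd_lucas_trace[of u k] n k by (auto simp: u_def)
  have "\<not> residually_p p (G\<lparr>carrier := H\<rparr>)"
  proof
    assume res: "residually_p p (G\<lparr>carrier := H\<rparr>)"
    interpret H: group "G\<lparr>carrier := H\<rparr>"
      using H(1) by (rule subgroup.subgroup_is_group) (rule group_axioms)
    obtain P :: "nat monoid" and \<alpha> where P: "p_group p P"
      and \<alpha>: "\<alpha> \<in> hom (G\<lparr>carrier := H\<rparr>) P" "\<alpha> (a [^] m) \<noteq> \<one>\<^bsub>P\<^esub>"
      using res m inf unfolding residually_p_def by fastforce
    interpret P: group P using P by (simp add: p_group_def)
    obtain j where j: "order P = p ^ j" using P by (auto simp: p_group_def)
    have \<alpha>_mult: "\<alpha> (x \<otimes> y) = \<alpha> x \<otimes>\<^bsub>P\<^esub> \<alpha> y" if "x \<in> H" "y \<in> H" for x y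
      using \<alpha>(1) that by (auto simp: hom_def)
    have \<alpha>_carr: "\<alpha> x \<in> carrier P" if "x \<in> H" for x
      using \<alpha>(1) that by (auto simp: hom_def)
    have \<alpha>_int_pow: "\<alpha> (x [^] i) = \<alpha> x [^]\<^bsub>P\<^esub> i" if "x \<in> H" for x and i :: int
      using hom_int_pow[OF \<alpha>(1) _ H.group_axioms P.group_axioms, of x i] that H(1)
      by (simp add: int_pow_consistent)
    \<comment> \<open>The factor \<open>p\<^sup>j\<close> kills the image of the power of \<open>s\<close> and, being odd, keeps the trace divisible by \<open>p\<close>.\<close>
    define N where "N = 2 * k * p ^ j"
    have sH: "s [^] (k * i) \<in> H" for i
    proof -
      have "(s [^] k) [^] i \<in> H"
        using k H.nat_pow_closed[of "s [^] k" i] by (simp flip: nat_pow_consistent)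
      then show ?thesis using carr by (simp add: nat_pow_pow)
    qed
    have \<alpha>_s: "\<alpha> (s [^] (N * i)) = \<one>\<^bsub>P\<^esub>" for i
    proof -
      have "s [^] (N * i) = (s [^] (k * (2 * i))) [^] int (p ^ j)"
      proof -
        have "N * i = k * (2 * i) * p ^ j" by (simp add: N_def)
        then show ?thesis
          unfolding int_pow_int using carr by (metis nat_pow_pow)
      qed
      then have "\<alpha> (s [^] (N * i)) = \<alpha> (s [^] (k * (2 * i))) [^]\<^bsub>P\<^esub> int (p ^ j)"
        using \<alpha>_int_pow[OF sH] by simp
      then show ?thesis
        using P.pow_order_eq_1[OF \<alpha>_carr[OF sH]] by (simp add: j[symmetric] int_pow_int)
    qed
    define z where "z = \<alpha> (a [^] m)"
    have z: "z \<in> carrier P" using \<alpha>_carr m by (simp add: z_def)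
    have sNH: "s [^] (N * i) \<in> H" for i
      using sH[of "2 * p ^ j * i"] by (simp add: N_def mult_ac)
    have eH: "e (v (N * i)) \<in> H" for i
    proof -
      have "e (v (N * i)) = inv (s [^] (N * i)) \<otimes> (e (v 0) \<otimes> s [^] (N * i))"
        unfolding v_conj using carr e_carr by (simp add: m_assoc[symmetric])
      then show ?thesis
        using sNH m H(1) unfolding v0
        by (simp add: subgroup.m_closed subgroup.m_inv_closed)
    qed
    have \<alpha>_e: "\<alpha> (e (v (N * i))) = z" for i
    proof -
      have "z \<otimes>\<^bsub>P\<^esub> \<alpha> (s [^] (N * i)) = \<alpha> (s [^] (N * i)) \<otimes>\<^bsub>P\<^esub> \<alpha> (e (v (N * i)))"
        using v_conj[of "N * i"] \<alpha>_mult[OF _ sNH] \<alpha>_mult[OF sNH eH] m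
        unfolding v0 z_def by metis
      then show ?thesis
        using z \<alpha>_carr[OF eH] by (simp add: \<alpha>_s)
    qed
    \<comment> \<open>The three terms of the recurrence all have image \<open>z\<close>.\<close>
    have "\<alpha> (e (v (N * 2)) \<otimes> e (v (N * 0))) = \<alpha> (e (v (N * 1)) [^] lucas_trace u N)"
      using v_sum[of N] by (simp add: mult.commute)
    then have zz: "z \<otimes>\<^bsub>P\<^esub> z = z [^]\<^bsub>P\<^esub> lucas_trace u N"
      unfolding \<alpha>_mult[OF eH eH] \<alpha>_int_pow[OF eH] \<alpha>_e .
    have "z [^]\<^bsub>P\<^esub> (lucas_trace u N - 2) = \<one>\<^bsub>P\<^esub>"
    proof -
      have "z [^]\<^bsub>P\<^esub> (2::int) = z \<otimes>\<^bsub>P\<^esub> z"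
        using z P.int_pow_mult[of z 1 1] by (simp add: P.int_pow_1)
      then show ?thesis using z zz by (simp add: P.int_pow_diff)
    qed
    moreover have "z [^]\<^bsub>P\<^esub> int (p ^ j) = \<one>\<^bsub>P\<^esub>"
      using P.pow_order_eq_1[OF z] by (simp add: j[symmetric] int_pow_int)
    moreover have "coprime (lucas_trace u N - 2) (int (p ^ j))"
    proof -
      have "int p dvd lucas_trace u N"
        using dvd_lucas_trace_odd[OF p(3), of "p ^ j"] p(2)
        by (simp add: N_def lucas_trace_mult)
      moreover have "\<not> int p dvd 2"
      proof -
        have "\<not> p dvd 2"
          using primes_dvd_imp_eq[OF p(1) two_is_prime_nat] p(2) by auto
        then show ?thesis using int_dvd_int_iff[of p 2] by simp
      qed
      ultimately have "\<not> int p dvd lucas_trace u N - 2"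
        using dvd_diff[of "int p" "lucas_trace u N" "lucas_trace u N - 2"] by auto
      then have "coprime (int p) (lucas_trace u N - 2)"
        using p(1) by (intro prime_imp_coprime) auto
      then show ?thesis by (simp add: coprime_commute)
    qed
    ultimately have "z = \<one>\<^bsub>P\<^esub>"
      using P.pow_eq_one_of_coprime[OF z] by blast
    then show False using \<alpha>(2) by (simp add: z_def)
  qed
  with p(1) show ?thesis by blast
qed

section \<open>The fundamental group as a group\<close>

lemma loop_class_eqI: "homotopic_paths S g h \<Longrightarrow> loop_class S g = loop_class S h"
  unfolding loop_class_def by (auto intro: homotopic_paths_trans homotopic_paths_sym)

lemma const_in_loops: "x0 \<in> S \<Longrightarrow> (\<lambda>_. x0) \<in> loops S x0"
  by (auto simp: loops_def path_def path_image_def pathstart_def pathfinish_def)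

lemma join_in_loops: "g \<in> loops S x0 \<Longrightarrow> h \<in> loops S x0 \<Longrightarrow> g +++ h \<in> loops S x0"
  by (auto simp: loops_def path_image_join)

lemma reversepath_in_loops: "g \<in> loops S x0 \<Longrightarrow> reversepath g \<in> loops S x0"
  by (auto simp: loops_def)

text \<open>In a real interval any two paths with the same end points are homotopic. Composing \<open>g\<close> with such
  homotopies of the parameter gives the group laws in a space without linear structure.\<close>

lemma homotopic_paths_const_join:
  fixes g :: "real \<Rightarrow> 'a::topological_space"
  assumes "path g" "path_image g \<subseteq> S"
  shows "homotopic_paths S ((\<lambda>_. pathstart g) +++ g) g"
proof -
  have "homotopic_paths {0..1} (linepath 0 0 +++ linepath 0 1) (linepath 0 (1::real))"
    by (rule homotopic_paths_lid') (auto simp: closed_segment_eq_real_ivl)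
  then have "homotopic_paths S (g \<circ> (linepath 0 0 +++ linepath 0 1)) (g \<circ> linepath 0 1)"
    using assms by (rule_tac homotopic_paths_continuous_image) (auto simp: path_def path_image_def)
  moreover have "g \<circ> linepath 0 1 = g" "g \<circ> linepath 0 0 = (\<lambda>_. pathstart g)"
    by (auto simp: linepath_def pathstart_def)
  ultimately show ?thesis by (simp add: path_compose_join)
qed

lemma homotopic_paths_reversepath_join:
  fixes g :: "real \<Rightarrow> 'a::topological_space"
  assumes "path g" "path_image g \<subseteq> S"
  shows "homotopic_paths S (reversepath g +++ g) (\<lambda>_. pathfinish g)"
proof -
  have "homotopic_paths {0..1} (reversepath (linepath 0 1) +++ linepath 0 1) (linepath 1 (1::real))"
    using homotopic_paths_linv[of "linepath 0 (1::real)" "{0..1}"] by (simp add: closed_segment_eq_real_ivl)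
  then have "homotopic_paths S (g \<circ> (reversepath (linepath 0 1) +++ linepath 0 1)) (g \<circ> linepath 1 1)"
    using assms by (rule_tac homotopic_paths_continuous_image) (auto simp: path_def path_image_def)
  moreover have "g \<circ> linepath 0 1 = g" "g \<circ> linepath 1 1 = (\<lambda>_. pathfinish g)"
    by (auto simp: linepath_def pathfinish_def)
  ultimately show ?thesis by (simp only: path_compose_join path_compose_reversepath)
qed

lemma group_fundamental_group:
  assumes "x0 \<in> S"
  shows "group (fundamental_group S x0)"
proof (rule groupI)
  let ?G = "fundamental_group S x0"
  have carr: "carrier ?G = loop_class S ` loops S x0"
    and one: "\<one>\<^bsub>?G\<^esub> = loop_class S (\<lambda>_. x0)"
    by (simp_all add: fundamental_group_def)
  show "\<one>\<^bsub>?G\<^esub> \<in> carrier ?G"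
    using const_in_loops[OF assms] by (simp add: carr one)
  fix C assume "C \<in> carrier ?G"
  then obtain g where g: "g \<in> loops S x0" "C = loop_class S g" by (auto simp: carr)
  have "homotopic_paths S ((\<lambda>_. x0) +++ g) g"
    using homotopic_paths_const_join[of g S] g by (simp add: loops_def)
  then show "\<one>\<^bsub>?G\<^esub> \<otimes>\<^bsub>?G\<^esub> C = C"
    using g const_in_loops[OF assms]
    by (simp add: one fundamental_group_mult loop_class_eqI join_in_loops)
  have "homotopic_paths S (reversepath g +++ g) (\<lambda>_. x0)"
    using homotopic_paths_reversepath_join[of g S] g by (simp add: loops_def)
  then have "loop_class S (reversepath g) \<otimes>\<^bsub>?G\<^esub> C = \<one>\<^bsub>?G\<^esub>"
    using g by (simp add: one fundamental_group_mult loop_class_eqI join_in_loops reversepath_in_loops)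
  then show "\<exists>D\<in>carrier ?G. D \<otimes>\<^bsub>?G\<^esub> C = \<one>\<^bsub>?G\<^esub>"
    using g by (auto simp: carr reversepath_in_loops)
  fix D assume "D \<in> carrier ?G"
  then obtain h where h: "h \<in> loops S x0" "D = loop_class S h" by (auto simp: carr)
  show "C \<otimes>\<^bsub>?G\<^esub> D \<in> carrier ?G"
    using g h by (simp add: carr fundamental_group_mult join_in_loops)
  fix E assume "E \<in> carrier ?G"
  then obtain k where k: "k \<in> loops S x0" "E = loop_class S k" by (auto simp: carr)
  have "homotopic_paths S ((g +++ h) +++ k) (g +++ (h +++ k))"
    using g h k by (intro homotopic_paths_sym[OF homotopic_paths_assoc]) (auto simp: loops_def)
  then show "C \<otimes>\<^bsub>?G\<^esub> D \<otimes>\<^bsub>?G\<^esub> E = C \<otimes>\<^bsub>?G\<^esub> (D \<otimes>\<^bsub>?G\<^esub> E)"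
    using g h k by (simp add: fundamental_group_mult loop_class_eqI join_in_loops)
qed

text \<open>Powers are taken at the level of loops because winding numbers and composition with maps are defined
  on loops and not on classes.\<close>

primrec loop_pow :: "(real \<Rightarrow> 'a::topological_space) \<Rightarrow> nat \<Rightarrow> real \<Rightarrow> 'a" where
  "loop_pow g 0 = (\<lambda>_. pathstart g)"
| "loop_pow g (Suc n) = loop_pow g n +++ g"

lemma loop_pow_in_loops: "g \<in> loops S x0 \<Longrightarrow> loop_pow g n \<in> loops S x0"
proof (induction n)
  case 0
  then have "x0 \<in> S" "pathstart g = x0"
    by (auto simp: loops_def)
  then show ?case by (simp add: const_in_loops)
qed (auto simp: join_in_loops)

lemma loop_class_pow:
  assumes "g \<in> loops S x0"
  shows "loop_class S g [^]\<^bsub>fundamental_group S x0\<^esub> n = loop_class S (loop_pow g n)"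
proof (induction n)
  case 0
  then show ?case using assms by (simp add: nat_pow_def fundamental_group_def loops_def)
next
  case (Suc n)
  have "loop_class S g [^]\<^bsub>fundamental_group S x0\<^esub> Suc n
      = loop_class S g [^]\<^bsub>fundamental_group S x0\<^esub> n \<otimes>\<^bsub>fundamental_group S x0\<^esub> loop_class S g"
    by (simp add: nat_pow_def)
  then show ?case
    using Suc assms by (simp add: fundamental_group_mult loop_pow_in_loops)
qed

lemma loop_pow_compose: "f \<circ> loop_pow g n = loop_pow (f \<circ> g) n"
proof (induction n)
  case (Suc n)
  then show ?case by (simp only: loop_pow.simps path_compose_join)
qed (simp add: comp_def pathstart_def)

lemma loops_image:
  assumes "g \<in> loops S x0" "continuous_on S f" "f \<in> S \<rightarrow> S'"
  shows "f \<circ> g \<in> loops S' (f x0)"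
proof -
  have "path (f \<circ> g)"
    using assms by (intro path_continuous_image) (auto simp: loops_def intro: continuous_on_subset)
  then show ?thesis
    using assms by (auto simp: loops_def path_image_compose pathstart_compose pathfinish_compose)
qed

lemma homotopic_paths_eq_cong:
  assumes "homotopic_paths S p q"
    and "\<And>t. t \<in> {0..1} \<Longrightarrow> p t = p' t" "\<And>t. t \<in> {0..1} \<Longrightarrow> q t = q' t"
  shows "homotopic_paths S p' q'"
proof -
  have pq: "path p" "path_image p \<subseteq> S" "path q" "path_image q \<subseteq> S"
    using homotopic_paths_imp_path[OF assms(1)] homotopic_paths_imp_subset[OF assms(1)] by auto
  have "homotopic_paths S p p'" "homotopic_paths S q q'"
    using homotopic_paths_eq[OF pq(1,2) assms(2)] homotopic_paths_eq[OF pq(3,4) assms(3)] by simp_all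
  then show ?thesis
    using assms(1) by (meson homotopic_paths_sym homotopic_paths_trans)
qed

text \<open>Any two paths between opposite corners of the convex square are homotopic in it. When \<open>K\<close> takes the
  same values on the two sides of the square on which its second coordinate is constant, this is a
  conjugation relation between the loops on the other two sides.\<close>

lemma homotopic_paths_square:
  fixes K :: "real \<times> real \<Rightarrow> 'a::topological_space"
  assumes "continuous_on ({0..1} \<times> {0..1}) K" "K \<in> ({0..1} \<times> {0..1}) \<rightarrow> S"
  shows "homotopic_paths S ((\<lambda>u. K (0, u)) +++ (\<lambda>t. K (t, 1))) ((\<lambda>t. K (t, 0)) +++ (\<lambda>u. K (1, u)))"
proof -
  let ?Q = "{0..1::real} \<times> {0..1::real}"
  let ?g = "linepath (0,0) (0,1) +++ linepath (0,1) (1,1) :: real \<Rightarrow> real \<times> real"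
  let ?h = "linepath (0,0) (1,0) +++ linepath (1,0) (1,1) :: real \<Rightarrow> real \<times> real"
  have Q: "convex ?Q" by (intro convex_Times) auto
  have "path_image ?g \<subseteq> ?Q" "path_image ?h \<subseteq> ?Q"
    using Q by (simp_all add: path_image_join closed_segment_subset)
  then have "homotopic_paths ?Q ?g ?h"
    using Q by (intro homotopic_paths_linear closed_segment_subset) (simp_all add: path_image_def image_subset_iff)
  then have "homotopic_paths S (K \<circ> ?g) (K \<circ> ?h)"
    using assms by (rule homotopic_paths_continuous_image)
  moreover have "K \<circ> linepath (0,0) (0,1) = (\<lambda>u. K (0, u))" "K \<circ> linepath (0,1) (1,1) = (\<lambda>t. K (t, 1))"
    "K \<circ> linepath (0,0) (1,0) = (\<lambda>t. K (t, 0))" "K \<circ> linepath (1,0) (1,1) = (\<lambda>u. K (1, u))"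
    by (auto simp: fun_eq_iff linepath_def)
  ultimately show ?thesis by (simp add: path_compose_join)
qed

lemma homotopic_paths_Times:
  assumes "homotopic_paths A p q" "homotopic_paths B p' q'"
  shows "homotopic_paths (A \<times> B) (\<lambda>t. (p t, p' t)) (\<lambda>t. (q t, q' t))"
proof -
  obtain h where h: "continuous_on ({0..1} \<times> {0..1}) h" "h \<in> ({0..1} \<times> {0..1}) \<rightarrow> A"
     "\<forall>x\<in>{0..1}. h (0,x) = p x" "\<forall>x\<in>{0..1}. h (1,x) = q x"
     "\<forall>t\<in>{0..1::real}. pathstart (h \<circ> Pair t) = pathstart p \<and> pathfinish (h \<circ> Pair t) = pathfinish p"
    using assms(1) unfolding homotopic_paths by blast
  obtain k where k: "continuous_on ({0..1} \<times> {0..1}) k" "k \<in> ({0..1} \<times> {0..1}) \<rightarrow> B"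
     "\<forall>x\<in>{0..1}. k (0,x) = p' x" "\<forall>x\<in>{0..1}. k (1,x) = q' x"
     "\<forall>t\<in>{0..1::real}. pathstart (k \<circ> Pair t) = pathstart p' \<and> pathfinish (k \<circ> Pair t) = pathfinish p'"
    using assms(2) unfolding homotopic_paths by blast
  show ?thesis
    unfolding homotopic_paths
    using h k by (intro exI[of _ "\<lambda>z. (h z, k z)"])
      (auto intro!: continuous_intros simp: pathstart_def pathfinish_def)
qed

section \<open>Winding numbers of loops in the torus\<close>

text \<open>The winding number classifies paths in the punctured plane, and the punctured plane retracts to the
  circle by \<open>z \<mapsto> z / |z|\<close>.\<close>

lemma homotopic_paths_circle_iff:
  assumes "path g" "path_image g \<subseteq> circle" "path h" "path_image h \<subseteq> circle"
    and "pathstart h = pathstart g" "pathfinish h = pathfinish g"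
  shows "homotopic_paths circle g h \<longleftrightarrow> winding_number g 0 = winding_number h 0"
proof
  assume "homotopic_paths circle g h"
  then have "homotopic_paths (-{0}) g h"
    by (rule homotopic_paths_subset) auto
  then show "winding_number g 0 = winding_number h 0"
    by (rule winding_number_homotopic_paths)
next
  assume "winding_number g 0 = winding_number h 0"
  moreover have "0 \<notin> path_image g" "0 \<notin> path_image h" using assms by auto
  ultimately have "homotopic_paths (-{0}) g h"
    using assms winding_number_homotopic_paths_eq by metis
  then have *: "homotopic_paths circle (sgn \<circ> g) (sgn \<circ> h)"
    by (rule homotopic_paths_continuous_image) (auto intro!: continuous_intros simp: norm_sgn)
  have "sgn (g t) = g t" "sgn (h t) = h t" if "t \<in> {0..1}" for t
    using that assms by (auto simp: path_image_def sgn_div_norm image_subset_iff)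
  then show "homotopic_paths circle g h"
    using assms homotopic_paths_trans[OF homotopic_paths_trans[OF _ *]]
      homotopic_paths_eq[of g circle "sgn \<circ> g"] homotopic_paths_eq[of h circle "sgn \<circ> h"]
    by (metis comp_apply homotopic_paths_sym)
qed

definition torus_winding :: "(real \<Rightarrow> complex \<times> complex) \<Rightarrow> complex \<times> complex" where
  "torus_winding g = (winding_number (fst \<circ> g) 0, winding_number (snd \<circ> g) 0)"

lemma torus_component_loops:
  assumes "g \<in> loops torus y"
  shows "fst \<circ> g \<in> loops circle (fst y)" "snd \<circ> g \<in> loops circle (snd y)"
  using assms by (auto intro!: loops_image[where S = torus] continuous_intros)

lemma homotopic_loops_torus_winding:
  assumes "homotopic_loops torus g h"
  shows "torus_winding g = torus_winding h"
proof -
  have "homotopic_loops (-{0}) (fst \<circ> g) (fst \<circ> h)" "homotopic_loops (-{0}) (snd \<circ> g) (snd \<circ> h)"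
    by (rule homotopic_loops_continuous_image[OF assms], auto intro!: continuous_intros)+
  then show ?thesis
    by (simp add: torus_winding_def winding_number_homotopic_loops)
qed

text \<open>The torus is a product, and so are its homotopies. Together with the additivity below this embeds the
  fundamental group of the torus in a vector group, which is the source of its commutativity.\<close>

lemma homotopic_paths_torus_iff:
  assumes "g \<in> loops torus y" "h \<in> loops torus y"
  shows "homotopic_paths torus g h \<longleftrightarrow> torus_winding g = torus_winding h"
proof
  assume "homotopic_paths torus g h"
  then have "homotopic_loops torus g h"
    using assms by (intro homotopic_paths_imp_homotopic_loops) (auto simp: loops_def)
  then show "torus_winding g = torus_winding h"
    by (rule homotopic_loops_torus_winding)
next
  assume "torus_winding g = torus_winding h"
  then have "homotopic_paths circle (fst \<circ> g) (fst \<circ> h)" "homotopic_paths circle (snd \<circ> g) (snd \<circ> h)"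
    using torus_component_loops[OF assms(1)] torus_component_loops[OF assms(2)]
    by (subst homotopic_paths_circle_iff; simp add: loops_def torus_winding_def)+
  from homotopic_paths_Times[OF this] show "homotopic_paths torus g h" by simp
qed

lemma torus_winding_join:
  assumes "g \<in> loops torus y" "h \<in> loops torus y"
  shows "torus_winding (g +++ h) = torus_winding g + torus_winding h"
proof -
  have "0 \<notin> circle" by simp
  then have "0 \<notin> path_image g" if "g \<in> loops circle x" for g x
    using that by (auto simp: loops_def)
  then show ?thesis
    using torus_component_loops[OF assms(1)] torus_component_loops[OF assms(2)]
    by (auto simp: torus_winding_def path_compose_join loops_def intro!: winding_number_join)
qed

lemma torus_winding_const: "y \<in> torus \<Longrightarrow> torus_winding (\<lambda>_. y) = 0"
  by (auto simp: torus_winding_def comp_def zero_prod_def intro!: winding_number_zero_const)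

lemma torus_winding_pow:
  assumes "g \<in> loops torus y"
  shows "torus_winding (loop_pow g n) = real n *\<^sub>R torus_winding g"
proof (induction n)
  case 0
  have "y \<in> torus" "pathstart g = y" using assms by (auto simp: loops_def)
  then show ?case by (simp add: torus_winding_const)
next
  case (Suc n)
  then show ?case
    using torus_winding_join[OF loop_pow_in_loops[OF assms] assms]
    by (simp add: algebra_simps)
qed

section \<open>Winding numbers of singular chains\<close>

definition loop_simplex :: "(real \<Rightarrow> 'a) \<Rightarrow> (nat \<Rightarrow> real) \<Rightarrow> 'a" where
  "loop_simplex g = restrict (\<lambda>x. g (x 1)) (standard_simplex 1)"

text \<open>A singular 1-simplex as a path, through barycentric coordinates.\<close>

definition edge_path :: "((nat \<Rightarrow> real) \<Rightarrow> 'a) \<Rightarrow> real \<Rightarrow> 'a" where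
  "edge_path s u = s (\<lambda>i. if i = 0 then 1 - u else if i = 1 then u else 0)"

text \<open>The edges of a chain need not be loops, so that the values are arbitrary complex numbers. The map \<open>q\<close>
  will be a coordinate of the torus.\<close>

definition chain_winding :: "('a \<Rightarrow> complex) \<Rightarrow> 'a chain \<Rightarrow> complex" where
  "chain_winding q c = (\<Sum>s\<in>Poly_Mapping.keys c.
     of_int (Poly_Mapping.lookup c s) * winding_number (q \<circ> edge_path s) 0)"

lemma chain_winding_superset:
  assumes "finite S" "Poly_Mapping.keys c \<subseteq> S"
  shows "chain_winding q c = (\<Sum>s\<in>S. of_int (Poly_Mapping.lookup c s) * winding_number (q \<circ> edge_path s) 0)"
  unfolding chain_winding_def using assms
  by (intro sum.mono_neutral_left) (auto simp: in_keys_iff)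

lemma chain_winding_diff: "chain_winding q (c - d) = chain_winding q c - chain_winding q d"
proof -
  let ?S = "Poly_Mapping.keys c \<union> Poly_Mapping.keys d"
  have "Poly_Mapping.keys (c - d) \<subseteq> ?S"
    by (auto simp: in_keys_iff lookup_minus)
  then show ?thesis
    by (subst (1 2 3) chain_winding_superset[of ?S])
      (auto simp: lookup_minus algebra_simps sum_subtractf)
qed

lemma chain_winding_0 [simp]: "chain_winding q 0 = 0"
  by (simp add: chain_winding_def)

lemma chain_winding_add: "chain_winding q (c + d) = chain_winding q c + chain_winding q d"
  using chain_winding_diff[of q "c + d" d] by simp

lemma chain_winding_cmul: "chain_winding q (frag_cmul (int n) c) = of_nat n * chain_winding q c"
  by (induction n) (simp_all add: frag_cmul_distrib chain_winding_add algebra_simps)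

lemma chain_winding_of: "chain_winding q (frag_of s) = winding_number (q \<circ> edge_path s) 0"
  by (simp add: chain_winding_def)

text \<open>Seen in the plane, two edges of the triangle, one after the other, are homotopic to the third. The
  simplex carries this to the punctured plane, where the winding number is additive.\<close>

lemma chain_winding_boundary_simplex:
  assumes \<sigma>: "singular_simplex 2 (top_of_set T) \<sigma>"
    and q: "continuous_on T q" "q \<in> T \<rightarrow> - {0}"
  shows "chain_winding q (chain_boundary 2 (frag_of \<sigma>)) = 0"
proof -
  \<comment> \<open>The standard 2-simplex, projected to its last two barycentric coordinates; \<open>\<tau>\<close> is the inverse of the projection.\<close>
  define \<Delta> where "\<Delta> = convex hull {(0,0), (1,0), (0,1 :: real) :: real \<times> real}"
  define \<tau> where "\<tau> = (\<lambda>(x, y) i::nat. if i = 0 then 1 - x - y else if i = 1 then x else if i = 2 then y else 0 :: real)"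
  have \<Delta>: "0 \<le> x \<and> 0 \<le> y \<and> x + y \<le> 1" if "(x, y) \<in> \<Delta>" for x y
    using that by (auto simp: \<Delta>_def convex_hull_3)
  have \<tau>: "\<tau> z \<in> standard_simplex 2" if "z \<in> \<Delta>" for z
    using \<Delta>[of "fst z" "snd z"] that
    by (auto simp: standard_simplex_def \<tau>_def numeral_2_eq_2 split: prod.splits)
  have "continuous_map (top_of_set \<Delta>) (subtopology (powertop_real UNIV) (standard_simplex 2)) \<tau>"
    unfolding continuous_map_in_subtopology continuous_map_componentwise_UNIV
  proof (intro conjI allI)
    fix i
    show "continuous_map (top_of_set \<Delta>) euclideanreal (\<lambda>z. \<tau> z i)"
      unfolding continuous_map_iff_continuous
      by (cases "i = 0"; cases "i = 1"; cases "i = 2")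
        (auto simp: \<tau>_def case_prod_unfold intro!: continuous_intros)
  qed (use \<tau> in auto)
  then have "continuous_map (top_of_set \<Delta>) (top_of_set T) (\<sigma> \<circ> \<tau>)"
    using \<sigma> unfolding singular_simplex_def by (blast intro: continuous_map_compose)
  then have \<sigma>\<tau>: "continuous_on \<Delta> (\<sigma> \<circ> \<tau>)" "\<sigma> \<circ> \<tau> \<in> \<Delta> \<rightarrow> T"
    by (auto simp: continuous_map_iff_continuous continuous_map_in_subtopology)
  define Q where "Q = q \<circ> (\<sigma> \<circ> \<tau>)"
  have Q: "continuous_on \<Delta> Q" "Q \<in> \<Delta> \<rightarrow> - {0}"
  proof -
    show "continuous_on \<Delta> Q"
      using continuous_on_compose2[OF q(1) \<sigma>\<tau>(1)] \<sigma>\<tau>(2) by (auto simp: Q_def comp_def)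
    show "Q \<in> \<Delta> \<rightarrow> - {0}"
      using funcset_mem[OF q(2) funcset_mem[OF \<sigma>\<tau>(2)]] by (auto simp: Q_def)
  qed
  have mem: "(0,0) \<in> \<Delta>" "(1,0) \<in> \<Delta>" "(0,1) \<in> \<Delta>"
    by (auto simp: \<Delta>_def intro: hull_inc)
  have conv: "convex \<Delta>" by (simp add: \<Delta>_def)
  have seg: "closed_segment x y \<subseteq> \<Delta>" if "x \<in> \<Delta>" "y \<in> \<Delta>" for x y
    using that conv by (simp add: closed_segment_subset)
  let ?l = "\<lambda>x y. Q \<circ> linepath x y"
  have pth: "path (?l x y)" "0 \<notin> path_image (?l x y)" if "x \<in> \<Delta>" "y \<in> \<Delta>" for x y
    using seg[OF that] Q
    by (auto intro!: path_continuous_image continuous_on_subset[OF Q(1)] simp: path_image_compose Pi_iff subset_iff)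
  have "homotopic_paths \<Delta> (linepath (0,0) (1,0) +++ linepath (1,0) (0,1)) (linepath (0,0) (0,1))"
  proof (intro homotopic_paths_linear seg)
    fix t :: real assume t: "t \<in> {0..1}"
    have "path_image (linepath (0,0) (1,0) +++ linepath (1,0) (0,1)) \<subseteq> \<Delta>"
      using seg mem by (simp add: path_image_join)
    then show "(linepath (0,0) (1,0) +++ linepath (1,0) (0,1)) t \<in> \<Delta>"
      using t by (auto simp: path_image_def)
    have "path_image (linepath (0,0) (0,1)) \<subseteq> \<Delta>"
      using seg mem by simp
    then show "linepath (0,0) (0,1) t \<in> \<Delta>"
      using t by (auto simp: path_image_def)
  qed auto
  then have "homotopic_paths (- {0}) (?l (0,0) (1,0) +++ ?l (1,0) (0,1)) (?l (0,0) (0,1))"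
    unfolding path_compose_join[symmetric] by (rule homotopic_paths_continuous_image[OF _ Q])
  then have "winding_number (?l (0,0) (1,0) +++ ?l (1,0) (0,1)) 0 = winding_number (?l (0,0) (0,1)) 0"
    by (rule winding_number_homotopic_paths)
  then have sum: "winding_number (?l (0,0) (1,0)) 0 + winding_number (?l (1,0) (0,1)) 0 = winding_number (?l (0,0) (0,1)) 0"
    using pth mem by (simp add: winding_number_join pathfinish_compose pathstart_compose)
  have edge: "winding_number (q \<circ> edge_path (singular_face 2 k \<sigma>)) 0 = winding_number (?l x y) 0"
    if "\<And>u. u \<in> {0..1} \<Longrightarrow> simplical_face k (\<lambda>i. if i = 0 then 1 - u else if i = 1 then u else 0) = \<tau> (linepath x y u)" for k x y
  proof (rule winding_number_cong)
    fix u :: real assume u: "0 \<le> u" "u \<le> 1"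
    have "(\<lambda>i. if i = 0 then 1 - u else if i = 1 then u else 0) \<in> standard_simplex (Suc 0)"
      using u by (auto simp: standard_simplex_def)
    then show "(q \<circ> edge_path (singular_face 2 k \<sigma>)) u = ?l x y u"
      using that[of u] u by (simp add: edge_path_def singular_face_def Q_def)
  qed
  have "winding_number (q \<circ> edge_path (singular_face 2 0 \<sigma>)) 0 = winding_number (?l (1,0) (0,1)) 0"
    "winding_number (q \<circ> edge_path (singular_face 2 1 \<sigma>)) 0 = winding_number (?l (0,0) (0,1)) 0"
    "winding_number (q \<circ> edge_path (singular_face 2 2 \<sigma>)) 0 = winding_number (?l (0,0) (1,0)) 0"
    by (rule edge; auto simp: simplical_face_def \<tau>_def linepath_def fun_eq_iff)+
  moreover have "{..2::nat} = {0, 1, 2}" by auto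
  ultimately show ?thesis
    by (simp add: chain_boundary_of chain_winding_diff chain_winding_add chain_winding_of sum[symmetric])
qed

lemma chain_winding_boundary:
  assumes d: "singular_chain 2 (top_of_set T) d"
    and q: "continuous_on T q" "q \<in> T \<rightarrow> - {0}"
  shows "chain_winding q (chain_boundary 2 d) = 0"
  using d unfolding singular_chain_def
proof (induction d rule: frag_induction)
  case (one \<sigma>)
  then show ?case using chain_winding_boundary_simplex[OF _ q] by simp
qed (simp_all add: chain_boundary_diff chain_winding_diff)

text \<open>This replaces the Hurewicz homomorphism: a loop in the torus is recovered, up to
  homotopy, from the values of two such functionals on its homology class.\<close>

lemma chain_winding_homologous:
  assumes "homologous_rel 1 (top_of_set T) {} c d"
    and q: "continuous_on T q" "q \<in> T \<rightarrow> - {0}"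
  shows "chain_winding q c = chain_winding q d"
proof -
  obtain e where "singular_chain 2 (top_of_set T) e" "chain_boundary 2 e = c - d"
    using assms(1) by (auto simp: homologous_rel_def singular_boundary numeral_2_eq_2)
  then have "chain_winding q (c - d) = 0"
    using chain_winding_boundary[OF _ q] by metis
  then show ?thesis by (simp add: chain_winding_diff)
qed

lemma chain_winding_loop_simplex:
  "chain_winding q (frag_of (loop_simplex g)) = winding_number (q \<circ> g) 0"
  unfolding chain_winding_of
proof (rule winding_number_cong)
  fix u :: real assume "0 \<le> u" "u \<le> 1"
  then have "(\<lambda>i. if i = 0 then 1 - u else if i = 1 then u else 0) \<in> standard_simplex 1"
    by (auto simp: standard_simplex_def)
  then show "(q \<circ> edge_path (loop_simplex g)) u = (q \<circ> g) u"
    by (simp add: edge_path_def loop_simplex_def)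
qed

lemma loop_simplex_cycle:
  assumes "g \<in> loops T y"
  shows "singular_relcycle 1 (top_of_set T) {} (frag_of (loop_simplex g))"
proof -
  have "continuous_map (subtopology (powertop_real UNIV) (standard_simplex 1)) (top_of_set {0..1}) (\<lambda>x. x 1)"
    by (auto simp: continuous_map_in_subtopology standard_simplex_def
        intro!: continuous_map_from_subtopology continuous_map_product_projection)
  moreover have "continuous_map (top_of_set {0..1}) (top_of_set T) g"
    using assms by (auto simp: loops_def path_def path_image_def continuous_map_in_subtopology)
  ultimately have "continuous_map (subtopology (powertop_real UNIV) (standard_simplex 1)) (top_of_set T) (g \<circ> (\<lambda>x. x 1))"
    by (rule continuous_map_compose)
  then have "singular_simplex 1 (top_of_set T) (loop_simplex g)"
    unfolding singular_simplex_def loop_simplex_def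
    by (auto elim!: continuous_map_eq)
  moreover have "singular_face 1 0 (loop_simplex g) = singular_face 1 1 (loop_simplex g)"
  proof -
    have "singular_face 1 k (loop_simplex g) = (\<lambda>x\<in>standard_simplex 0. g 0)" if k: "k \<le> 1" for k
    proof
      fix x
      show "singular_face 1 k (loop_simplex g) x = (\<lambda>x\<in>standard_simplex 0. g 0) x"
      proof (cases "x \<in> standard_simplex 0")
        case True
        then have "simplical_face k x \<in> standard_simplex 1"
          using simplical_face_in_standard_simplex[of 1 k x] k by simp
        moreover have "simplical_face k x 1 = (if k = 0 then 1 else 0)"
          using True k by (auto simp: simplical_face_def standard_simplex_0)
        moreover have "g 0 = g 1"
          using assms by (auto simp: loops_def pathstart_def pathfinish_def)
        ultimately show ?thesis
          using True by (simp add: singular_face_def loop_simplex_def)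
      qed (simp add: singular_face_def)
    qed
    then show ?thesis by simp
  qed
  ultimately show ?thesis
    by (simp add: singular_cycle chain_boundary_of singular_chain_of)
qed

lemma chain_map_loop_simplex:
  "chain_map 1 f (frag_of (loop_simplex g)) = frag_of (loop_simplex (f \<circ> g))"
  by (auto simp: chain_map_of simplex_map_def loop_simplex_def restrict_def fun_eq_iff intro!: arg_cong[where f = frag_of])

section \<open>The monodromy on homology\<close>

lemma homology_mult:
  "homologous_rel_set 1 X {} a \<otimes>\<^bsub>homology_group 1 X\<^esub> homologous_rel_set 1 X {} b = homologous_rel_set 1 X {} (a + b)"
proof -
  have "x \<in> (\<Union>r\<in>homologous_rel_set 1 X {} a. \<Union>s\<in>homologous_rel_set 1 X {} b. {r + s})"
    if "homologous_rel 1 X {} (a + b) x" for x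
  proof -
    have "homologous_rel 1 X {} b (x - a)"
      using that by (simp add: homologous_rel_def algebra_simps)
    then show ?thesis by (intro UN_I[of a] UN_I[of "x - a"]) auto
  qed
  then show ?thesis
    using mult_relative_homology_group[of 1 X "{}", unfolded of_nat_1]
    by (auto intro: homologous_rel_add)
qed

lemma homology_pow:
  "homologous_rel_set 1 X {} a [^]\<^bsub>homology_group 1 X\<^esub> n = homologous_rel_set 1 X {} (frag_cmul (int n) a)"
proof (induction n)
  case 0
  then show ?case
    using one_relative_homology_group[of 1 X "{}", unfolded of_nat_1]
    by (auto simp: nat_pow_def homologous_rel_def singular_relboundary_minus)
next
  case (Suc n)
  then show ?case
    using homology_mult[of X "frag_cmul (int n) a" a]
    by (simp add: nat_pow_def frag_cmul_distrib add.commute)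
qed

text \<open>The Cayley--Hamilton theorem for a 2 by 2 matrix of determinant 1, written multiplicatively.\<close>

lemma (in comm_group) cayley_hamilton_Z2:
  fixes e :: "2 \<Rightarrow> 'a" and A :: "int ^ 2 ^ 2"
  assumes e: "is_Z_basis G e" and A: "represents G e \<phi> A" and \<phi>: "\<phi> \<in> hom G G"
    and tr: "A $ 1 $ 1 + A $ 2 $ 2 = n" and dt: "A $ 1 $ 1 * A $ 2 $ 2 - A $ 1 $ 2 * A $ 2 $ 1 = 1"
    and x: "x \<in> carrier G"
  shows "\<phi> (\<phi> x) \<otimes> x = \<phi> x [^] n"
proof -
  define E where "E = (\<lambda>(i, j). e 1 [^] (i::int) \<otimes> e 2 [^] (j::int))"
  have ec: "e i \<in> carrier G" for i using e by (auto simp: is_Z_basis_def)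
  have Ec: "E v \<in> carrier G" for v by (auto simp: E_def ec split: prod.splits)
  have fp: "(\<Otimes>i\<in>UNIV. e i [^] (m i)) = E (m 1, m 2)" for m :: "2 \<Rightarrow> int"
    by (simp add: UNIV_2 E_def ec)
  obtain m :: "int ^ 2" where m: "x = E (m $ 1, m $ 2)"
    using e x unfolding is_Z_basis_def bij_betw_def fp by auto
  have E_add: "E (i, j) \<otimes> E (k, l) = E (i + k, j + l)" for i j k l
    by (simp add: E_def ec int_pow_mult m_ac)
  have E_pow: "E (i, j) [^] k = E (i * k, j * k)" for i j k :: int
    by (simp add: E_def ec int_pow_distrib int_pow_pow)
  have "\<phi> (e j) = E (A $ 1 $ j, A $ 2 $ j)" for j
    using A unfolding represents_def fp by simp
  then have \<phi>E: "\<phi> (E (i, j)) = E (A $ 1 $ 1 * i + A $ 1 $ 2 * j, A $ 2 $ 1 * i + A $ 2 $ 2 * j)" for i j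
    using hom_mult[OF \<phi>, of "e 1 [^] i" "e 2 [^] j"] hom_int_pow[OF \<phi> ec group_axioms group_axioms]
    by (simp add: E_pow E_add ec) (simp add: E_def E_pow E_add ec)
  have CH: "a * (a * i + b * j) + b * (c * i + d * j) + i = (a * i + b * j) * (a + d)"
    if "a * d - b * c = 1" for a b c d i j :: int
  proof -
    have "a * d * i = b * c * i + i"
      using that by (metis add.commute diff_eq_eq distrib_right mult_1)
    then show ?thesis by (simp add: algebra_simps)
  qed
  show ?thesis
    unfolding m \<phi>E E_add E_pow tr[symmetric]
    using CH[of "A $ 1 $ 1" "A $ 2 $ 2" "A $ 1 $ 2" "A $ 2 $ 1" "m $ 1" "m $ 2"]
      CH[of "A $ 2 $ 2" "A $ 1 $ 1" "A $ 2 $ 1" "A $ 1 $ 2" "m $ 2" "m $ 1"] dt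
    by (intro arg_cong[where f = E]) (simp add: ac_simps)
qed

lemma eigenvalues_2x2:
  fixes A :: "int ^ 2 ^ 2"
  assumes "c \<in> eigenvalues A"
  shows "c\<^sup>2 - of_int (A $ 1 $ 1 + A $ 2 $ 2) * c + of_int (A $ 1 $ 1 * A $ 2 $ 2 - A $ 1 $ 2 * A $ 2 $ 1) = 0"
proof -
  obtain v where v: "v \<noteq> 0" "map_matrix of_int A *v v = c *s v"
    using assms by (auto simp: eigenvalues_def)
  have "(map_matrix of_int A *v v) $ i = of_int (A $ i $ 1) * v $ 1 + of_int (A $ i $ 2) * v $ 2" for i
    by (simp add: matrix_vector_mult_def map_matrix_def sum_2)
  then have eqs: "of_int (A $ 1 $ 1) * v $ 1 + of_int (A $ 1 $ 2) * v $ 2 = c * v $ 1"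
    "of_int (A $ 2 $ 1) * v $ 1 + of_int (A $ 2 $ 2) * v $ 2 = c * v $ 2"
    using v(2) by (simp_all flip: vector_smult_component)
  let ?p = "c\<^sup>2 - of_int (A $ 1 $ 1 + A $ 2 $ 2) * c + of_int (A $ 1 $ 1 * A $ 2 $ 2 - A $ 1 $ 2 * A $ 2 $ 1)"
  have CH: "(z\<^sup>2 - (a + d) * z + (a * d - b * c)) * p = 0"
    if "a * p + b * q = z * p" "c * p + d * q = z * q" for a b c d p q z :: complex
  proof -
    have "(z - a) * p = b * q" "(z - d) * q = c * p"
      using that by (simp_all add: left_diff_distrib add_diff_eq diff_eq_eq add.commute)
    then have "(z - d) * ((z - a) * p) = b * (c * p)"
      by (metis mult.left_commute)
    then show ?thesis by (simp add: algebra_simps power2_eq_square)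
  qed
  have "?p * v $ 1 = 0" "?p * v $ 2 = 0"
    using CH[OF eqs] CH[of _ _ _ _ c, OF eqs(2)[unfolded add.commute[of "_ * v $ 1"]] eqs(1)[unfolded add.commute[of "_ * v $ 1"]]]
    by (simp_all add: ac_simps)
  moreover have "v $ 1 \<noteq> 0 \<or> v $ 2 \<noteq> 0"
    using v(1) by (auto simp: vec_eq_iff forall_2)
  ultimately show ?thesis by auto
qed

text \<open>The two eigenvalues are distinct roots of the monic characteristic polynomial, so that trace and
  determinant are their sum and product.\<close>

lemma hyperbolic_trace_det:
  fixes A :: "int ^ 2 ^ 2"
  assumes "t > 0" "eigenvalues A = {complex_of_real (exp (- t)), complex_of_real (exp t)}"
  shows "A $ 1 $ 1 + A $ 2 $ 2 > 2" "A $ 1 $ 1 * A $ 2 $ 2 - A $ 1 $ 2 * A $ 2 $ 1 = 1"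
proof -
  define a where "a = real_of_int (A $ 1 $ 1 + A $ 2 $ 2)"
  define d where "d = real_of_int (A $ 1 $ 1 * A $ 2 $ 2 - A $ 1 $ 2 * A $ 2 $ 1)"
  define x where "x = exp t"
  have root: "y\<^sup>2 - a * y + d = 0" if "complex_of_real y \<in> eigenvalues A" for y
  proof -
    have "complex_of_real (y\<^sup>2 - a * y + d) = 0"
      using eigenvalues_2x2[OF that] by (simp add: a_def d_def)
    then show ?thesis by (simp only: of_real_eq_0_iff)
  qed
  have x: "x > 1" using assms(1) by (simp add: x_def)
  have 1: "x\<^sup>2 - a * x + d = 0" using root[of x] assms(2) by (simp add: x_def)
  have 2: "(1/x)\<^sup>2 - a * (1/x) + d = 0"
    using root[of "1/x"] assms(2) by (simp add: x_def exp_minus divide_inverse)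
  have "(x - 1/x) * (x + 1/x - a) = 0"
    using 1 2 by (simp add: algebra_simps power2_eq_square)
  moreover have "x - 1/x \<noteq> 0"
  proof -
    have "1 / x < 1" using x by simp
    then show ?thesis using x by linarith
  qed
  ultimately have a: "a = x + 1/x" by simp
  have "d = a * x - x\<^sup>2" using 1 by simp
  then have "d = 1" using x unfolding a by (simp add: field_simps power2_eq_square)
  then show "A $ 1 $ 1 * A $ 2 $ 2 - A $ 1 $ 2 * A $ 2 $ 1 = 1"
    unfolding d_def by (simp only: of_int_eq_1_iff)
  have "(x - 1)\<^sup>2 > 0" using x by simp
  then have "a > 2" unfolding a using x by (simp add: field_simps power2_eq_square)
  then show "A $ 1 $ 1 + A $ 2 $ 2 > 2" unfolding a_def by linarith
qed

text \<open>The action of \<open>f\<close> on homology classes of loops is composition with \<open>f\<close>, so the winding functionals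
  translate the Cayley--Hamilton relation in homology into one between winding numbers.\<close>

proposition torus_winding_recurrence:
  fixes e :: "2 \<Rightarrow> (complex \<times> complex) chain set"
  assumes f: "continuous_on torus f" "f \<in> torus \<rightarrow> torus"
    and e: "is_Z_basis (homology_group 1 (top_of_set torus)) e"
    and A: "represents (homology_group 1 (top_of_set torus)) e
             (hom_induced 1 (top_of_set torus) {} (top_of_set torus) {} f) A"
    and t: "t > 0" "eigenvalues A = {complex_of_real (exp (- t)), complex_of_real (exp t)}"
  obtains n :: nat where "n > 2"
    "\<forall>y. \<forall>g\<in>loops torus y.
      torus_winding (f \<circ> (f \<circ> g)) + torus_winding g = real n *\<^sub>R torus_winding (f \<circ> g)"
proof
  let ?X = "top_of_set torus"
  let ?H = "homology_group 1 ?X"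
  let ?\<phi> = "hom_induced 1 ?X {} ?X {} f"
  let ?h = "\<lambda>g. homologous_rel_set 1 ?X {} (frag_of (loop_simplex g))"
  define n where "n = nat (A $ 1 $ 1 + A $ 2 $ 2)"
  note At = hyperbolic_trace_det[OF t]
  show "n > 2" using At by (simp add: n_def)
  show "\<forall>y. \<forall>g\<in>loops torus y.
      torus_winding (f \<circ> (f \<circ> g)) + torus_winding g = real n *\<^sub>R torus_winding (f \<circ> g)"
  proof (intro allI ballI)
    fix y g assume g: "g \<in> loops torus y"
    interpret H: comm_group ?H by simp
    have fX: "continuous_map ?X ?X f"
      using f by (auto simp: continuous_map_in_subtopology)
    have \<phi>h: "?\<phi> (?h k) = ?h (f \<circ> k)" if "k \<in> loops torus z" for k z
      using hom_induced_chain_map[OF fX _ loop_simplex_cycle[OF that], of "{}"]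
      unfolding chain_map_loop_simplex by simp
    have fg: "f \<circ> g \<in> loops torus (f y)" using loops_image[OF g f] .
    have hg: "?h g \<in> carrier ?H"
      using carrier_relative_homology_group[of 1 ?X "{}"] loop_simplex_cycle[OF g] by simp
    have "?\<phi> (?\<phi> (?h g)) \<otimes>\<^bsub>?H\<^esub> ?h g = ?\<phi> (?h g) [^]\<^bsub>?H\<^esub> int n"
    proof (rule H.cayley_hamilton_Z2[OF e A hom_induced_hom _ At(2) hg])
      show "A $ 1 $ 1 + A $ 2 $ 2 = int n" using At(1) by (simp add: n_def)
    qed
    then have rel: "homologous_rel 1 ?X {} (frag_of (loop_simplex (f \<circ> (f \<circ> g))) + frag_of (loop_simplex g))
        (frag_cmul (int n) (frag_of (loop_simplex (f \<circ> g))))"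
      unfolding \<phi>h[OF g] \<phi>h[OF fg] int_pow_int homology_mult homology_pow homologous_rel_set_eq .
    have "chain_winding q (frag_of (loop_simplex (f \<circ> (f \<circ> g)))) + chain_winding q (frag_of (loop_simplex g))
        = of_nat n * chain_winding q (frag_of (loop_simplex (f \<circ> g)))"
      if "continuous_on torus q" "q \<in> torus \<rightarrow> - {0}" for q
      using chain_winding_homologous[OF rel that] by (simp add: chain_winding_add chain_winding_cmul)
    moreover have "fst \<in> torus \<rightarrow> - {0}" "snd \<in> torus \<rightarrow> - {0}"
      by auto
    ultimately show "torus_winding (f \<circ> (f \<circ> g)) + torus_winding g = real n *\<^sub>R torus_winding (f \<circ> g)"
      unfolding chain_winding_loop_simplex
      by (simp add: torus_winding_def continuous_on_fst continuous_on_snd scaleR_conv_of_real)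
  qed
qed

section \<open>Lifting circle valued maps\<close>

lemma circle_valued_lift:
  fixes S :: "'b::real_normed_vector set"
  assumes "convex S" "continuous_on S q" "q \<in> S \<rightarrow> circle"
  obtains h where "continuous_on S h" "\<And>z. z \<in> S \<Longrightarrow> q z = cis (2 * pi * h z)"
proof -
  have nz: "q z \<noteq> 0" if "z \<in> S" for z using assms(3) that by force
  obtain g where g: "continuous_on S g" "\<And>z. z \<in> S \<Longrightarrow> q z = exp (g z)"
    using continuous_logarithm_on_contractible[OF assms(2) convex_imp_contractible[OF assms(1)] nz] by blast
  show ?thesis
  proof
    show "continuous_on S (\<lambda>z. Im (g z) / (2 * pi))"
      using g(1) by (intro continuous_intros) auto
    fix z assume z: "z \<in> S"
    then have "exp (Re (g z)) = 1" using assms(3) g(2)[OF z] by (auto simp: Pi_iff)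
    then show "q z = cis (2 * pi * (Im (g z) / (2 * pi)))"
      using g(2)[OF z] by (simp add: exp_eq_polar)
  qed
qed

lemma connected_boundary_square:
  "connected ({0,1} \<times> {0..1} \<union> {0..1} \<times> {0,1} :: (real \<times> real) set)"
proof -
  define I where "I = {0..1::real}"
  have I: "connected I" "0 \<in> I" "1 \<in> I" by (simp_all add: I_def)
  have c: "connected ({a} \<times> I)" "connected (I \<times> {a})" for a :: real
    using I(1) by (simp_all add: connected_Times)
  have "connected ({0} \<times> I \<union> I \<times> {0})"
    using I by (intro connected_Un c) blast
  then have "connected (({0} \<times> I \<union> I \<times> {0}) \<union> {1} \<times> I)"
    using I by (intro connected_Un c) blast+
  then have "connected ((({0} \<times> I \<union> I \<times> {0}) \<union> {1} \<times> I) \<union> I \<times> {1})"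
    using I by (intro connected_Un c) blast+
  moreover have "(({0} \<times> I \<union> I \<times> {0}) \<union> {1} \<times> I) \<union> I \<times> {1} = {0,1} \<times> I \<union> I \<times> {0,1}"
    by blast
  ultimately show ?thesis unfolding I_def by simp
qed

text \<open>Over a connected set on which \<open>q\<close> is constant, a lift differs from \<open>s\<close> by a single integer. A further
  integer translation makes the lift nonnegative on the compact set, so that the infinite cyclic cover
  is only ever needed over a half-line.\<close>

lemma circle_valued_lift_prescribed:
  fixes Q :: "'b::real_normed_vector set"
  assumes Q: "convex Q" "compact Q" and B: "B \<subseteq> Q" "connected B" "B \<noteq> {}"
    and q: "continuous_on Q q" "q \<in> Q \<rightarrow> circle" and qB: "\<And>z. z \<in> B \<Longrightarrow> q z = cis (2 * pi * s)"
  obtains h and M m :: nat where "continuous_on Q h" "h \<in> Q \<rightarrow> {0..real M}"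
    "\<And>z. z \<in> Q \<Longrightarrow> q z = cis (2 * pi * h z)" "\<And>z. z \<in> B \<Longrightarrow> h z = s + real m"
proof -
  obtain h0 where h0: "continuous_on Q h0" "\<And>z. z \<in> Q \<Longrightarrow> q z = cis (2 * pi * h0 z)"
    using circle_valued_lift[OF Q(1) q] by blast
  have int: "h0 z - s \<in> \<int>" if "z \<in> B" for z
  proof -
    have "cis (2 * pi * h0 z) = cis (2 * pi * s)"
      using h0(2)[of z] qB that B by auto
    then have "cis (2 * pi * (h0 z - s)) * cis (2 * pi * s) = cis (2 * pi * s)"
      by (simp add: cis_mult algebra_simps)
    then have "cis (2 * pi * (h0 z - s)) = 1" by simp
    then have "cos (2 * pi * (h0 z - s)) = 1" by (metis cis.simps(1) one_complex.simps(1))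
    then obtain n :: int where "2 * pi * (h0 z - s) = real_of_int n * 2 * pi"
      using cos_one_2pi_int by blast
    then show ?thesis by simp
  qed
  have "(\<lambda>z. h0 z - s) constant_on B"
  proof (rule continuous_discrete_range_constant[OF B(2)])
    show "continuous_on B (\<lambda>z. h0 z - s)"
      by (intro continuous_intros continuous_on_subset[OF h0(1) B(1)])
    fix z assume z: "z \<in> B"
    have "1 \<le> norm ((h0 w - s) - (h0 z - s))" if "w \<in> B" "h0 w - s \<noteq> h0 z - s" for w
      using Ints_nonzero_abs_ge1[OF Ints_diff[OF int[OF that(1)] int[OF z]]] that(2) by simp
    then show "\<exists>e>0. \<forall>w. w \<in> B \<and> h0 w - s \<noteq> h0 z - s \<longrightarrow> e \<le> norm ((h0 w - s) - (h0 z - s))"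
      by (intro exI[of _ 1]) auto
  qed
  then obtain c where c: "\<And>z. z \<in> B \<Longrightarrow> h0 z - s = c" by (auto simp: constant_on_def)
  have cZ: "c \<in> \<int>" using int c B(3) by fastforce
  have "bounded ((\<lambda>z. h0 z - c) ` Q)"
    by (intro compact_imp_bounded compact_continuous_image continuous_intros h0(1) Q(2))
  then obtain b where "\<forall>x\<in>(\<lambda>z. h0 z - c) ` Q. norm x \<le> b"
    unfolding bounded_iff ..
  then have b: "\<And>z. z \<in> Q \<Longrightarrow> \<bar>h0 z - c\<bar> \<le> b" by simp
  define m where "m = nat \<lceil>b\<rceil>"
  define h where "h = (\<lambda>z. h0 z - c + real m)"
  have m: "b \<le> real m" unfolding m_def by linarith
  show ?thesis
  proof
    show "continuous_on Q h" using h0(1) unfolding h_def by (intro continuous_intros)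
    have "0 \<le> h z \<and> h z \<le> real (2 * m)" if "z \<in> Q" for z
      using b[OF that] m by (simp add: h_def abs_le_iff)
    then show "h \<in> Q \<rightarrow> {0..real (2 * m)}" by auto
    show "h z = s + real m" if "z \<in> B" for z using c[OF that] by (simp add: h_def)
    fix z assume z: "z \<in> Q"
    have "real m - c \<in> \<int>" using cZ by simp
    then have "cis (2 * pi * (real m - c)) = 1" by (rule cis_multiple_2pi)
    moreover have "cis (2 * pi * h z) = cis (2 * pi * h0 z) * cis (2 * pi * (real m - c))"
      by (simp add: h_def cis_mult algebra_simps)
    ultimately show "q z = cis (2 * pi * h z)" using h0(2)[OF z] by simp
  qed
qed

section \<open>The infinite cyclic cover of a bundle over the circle\<close>

lemma floor_piece:
  assumes "0 \<le> (r::real)"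
  obtains n where "real n \<le> r" "r \<le> real n + 1"
  using assms that[of "nat \<lfloor>r\<rfloor>"] by simp

lemma cis_shift_nat: "cis (2 * pi * (r - real n)) = cis (2 * pi * r)"
proof -
  have 1: "cis (2 * pi * real n) = 1" by (rule cis_multiple_2pi) simp
  have "cis (2 * pi * (r - real n)) * cis (2 * pi * real n) = cis (2 * pi * r)"
    by (simp add: cis_mult algebra_simps)
  then show ?thesis unfolding 1 by simp
qed

text \<open>A trivialisation \<open>\<Phi>\<close> of the pullback of a bundle to the unit interval, with monodromy \<open>f\<close>. Compactness
  and the Hausdorff property serve to invert the trivialisation continuously.\<close>

locale monodromy_trivialisation =
  fixes N :: "'a::topological_space set" and p :: "'a \<Rightarrow> complex"
    and F :: "'c::topological_space set" and \<Phi> :: "'c \<times> real \<Rightarrow> 'a" and f :: "'c \<Rightarrow> 'c"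
  assumes Hausdorff: "Hausdorff_space (top_of_set N)"
    and p_cont: "continuous_on N p" and p_circle: "p \<in> N \<rightarrow> circle"
    and F_compact: "compact F"
    and \<Phi>_cont: "continuous_on (F \<times> {0..1}) \<Phi>"
    and \<Phi>_homeo: "s \<in> {0..1} \<Longrightarrow> \<exists>k. homeomorphism F (N \<inter> p -` {cis (2 * pi * s)}) (\<lambda>x. \<Phi> (x, s)) k"
    and f_F: "f \<in> F \<rightarrow> F" and glue: "x \<in> F \<Longrightarrow> \<Phi> (f x, 0) = \<Phi> (x, 1)"
begin

lemma \<Phi>_image: "s \<in> {0..1} \<Longrightarrow> (\<lambda>x. \<Phi> (x, s)) ` F = N \<inter> p -` {cis (2 * pi * s)}"
  using \<Phi>_homeo[of s] by (metis homeomorphism_image1)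

lemma \<Phi>_inj: "s \<in> {0..1} \<Longrightarrow> x \<in> F \<Longrightarrow> y \<in> F \<Longrightarrow> \<Phi> (x, s) = \<Phi> (y, s) \<longleftrightarrow> x = y"
  using \<Phi>_homeo[of s] by (metis homeomorphism_apply1)

text \<open>The gluing relation writes \<open>f\<close> as \<open>\<Phi>\<^sub>0\<^sup>-\<^sup>1 \<circ> \<Phi>\<^sub>1\<close>, a composition of two homeomorphisms.\<close>

lemma f_cont: "continuous_on F f"
proof -
  obtain k where k: "homeomorphism F (N \<inter> p -` {1}) (\<lambda>x. \<Phi> (x, 0)) k"
    using \<Phi>_homeo[of 0] by auto
  have im: "(\<lambda>x. \<Phi> (x, 1)) ` F = N \<inter> p -` {1}"
    using \<Phi>_image[of 1] by simp
  have c1: "continuous_on F (\<lambda>x. \<Phi> (x, 1))"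
    by (intro continuous_on_compose2[OF \<Phi>_cont] continuous_intros) auto
  have c2: "continuous_on (N \<inter> p -` {1}) k"
    using k by (simp add: homeomorphism_def)
  have "continuous_on F (\<lambda>x. k (\<Phi> (x, 1)))"
    by (rule continuous_on_compose2[OF c2 c1]) (simp add: im)
  moreover have "k (\<Phi> (x, 1)) = f x" if "x \<in> F" for x
    using that f_F k glue[OF that] homeomorphism_apply1[OF k, of "f x"] by auto
  ultimately show ?thesis by (simp cong: continuous_on_cong)
qed

lemma f_bij: "bij_betw f F F"
proof (rule bij_betw_imageI)
  show "inj_on f F"
    using \<Phi>_inj[of 1] glue by (intro inj_onI) (metis atLeastAtMost_iff order_refl zero_le_one)
  have "y \<in> f ` F" if y: "y \<in> F" for y
  proof -
    have "\<Phi> (y, 0) \<in> (\<lambda>x. \<Phi> (x, 1)) ` F"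
      using y \<Phi>_image[of 0] \<Phi>_image[of 1] by auto
    then obtain x where x: "x \<in> F" "\<Phi> (y, 0) = \<Phi> (x, 1)" by auto
    then have "y = f x" using \<Phi>_inj[of 0 y "f x"] y f_F glue by auto
    then show ?thesis using x by blast
  qed
  then show "f ` F = F" using f_F by auto
qed

lemma funpow_bij: "bij_betw (f ^^ n) F F"
  using f_bij by (induction n) (auto intro: bij_betw_trans)

lemma funpow_F: "x \<in> F \<Longrightarrow> (f ^^ n) x \<in> F"
  using funpow_bij[of n] by (auto simp: bij_betw_def)

lemma funpow_cont: "continuous_on F (f ^^ n)"
proof (induction n)
  case (Suc n)
  have "continuous_on F (\<lambda>x. f ((f ^^ n) x))"
    using Suc funpow_F by (intro continuous_on_compose2[OF f_cont]) auto
  then show ?case by (simp add: comp_def)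
qed (simp add: id_def)

text \<open>The trivialisations over the intervals \<open>[n, n+1]\<close> are glued by powers of the monodromy to one map on
  \<open>F \<times> [0,\<infinity>)\<close>: the nonnegative half of the infinite cyclic covering. Negative parameters carry no
  meaning.\<close>

definition \<Psi> :: "'c \<times> real \<Rightarrow> 'a" where
  "\<Psi> z = \<Phi> ((f ^^ nat \<lfloor>snd z\<rfloor>) (fst z), frac (snd z))"

text \<open>At the upper end \<open>r = n + 1\<close> the definition uses one more power of \<open>f\<close>; the two values agree by the
  gluing relation. This is what makes \<open>\<Psi>\<close> continuous at the integers.\<close>

lemma \<Psi>_piece:
  assumes "x \<in> F" "real n \<le> r" "r \<le> real n + 1"
  shows "\<Psi> (x, r) = \<Phi> ((f ^^ n) x, r - real n)"
proof (cases "r = real n + 1")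
  case True
  then have "\<lfloor>r\<rfloor> = int n + 1" by simp
  then show ?thesis
    using glue[OF funpow_F[OF assms(1)], of n] True by (simp add: \<Psi>_def frac_def nat_add_distrib)
next
  case False
  then have "\<lfloor>r\<rfloor> = int n" using assms by (simp add: floor_eq_iff)
  then show ?thesis by (simp add: \<Psi>_def frac_def)
qed

lemma \<Psi>_image:
  assumes "0 \<le> r"
  shows "(\<lambda>x. \<Psi> (x, r)) ` F = N \<inter> p -` {cis (2 * pi * r)}"
proof -
  obtain n where n: "real n \<le> r" "r \<le> real n + 1" using floor_piece[OF assms] .
  have "(\<lambda>x. \<Psi> (x, r)) ` F = (\<lambda>x. \<Phi> (x, r - real n)) ` (f ^^ n) ` F"
    using n by (auto simp: \<Psi>_piece image_image)
  also have "(f ^^ n) ` F = F" using funpow_bij[of n] by (simp add: bij_betw_def)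
  finally show ?thesis using \<Phi>_image[of "r - real n"] n by (simp add: cis_shift_nat)
qed

lemma \<Psi>_inj:
  assumes "0 \<le> r" "x \<in> F" "y \<in> F" "\<Psi> (x, r) = \<Psi> (y, r)"
  shows "x = y"
proof -
  obtain n where n: "real n \<le> r" "r \<le> real n + 1" using floor_piece[OF assms(1)] .
  have "(f ^^ n) x = (f ^^ n) y"
    using assms n \<Phi>_inj[of "r - real n" "(f ^^ n) x" "(f ^^ n) y"] funpow_F by (simp add: \<Psi>_piece)
  then show ?thesis using assms funpow_bij[of n] by (auto simp: bij_betw_def inj_on_def)
qed

lemma \<Psi>_cont: "continuous_on (F \<times> {0..real n}) \<Psi>"
proof (induction n)
  case 0
  have "continuous_on (F \<times> {0}) \<Phi>" by (rule continuous_on_subset[OF \<Phi>_cont]) auto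
  moreover have "\<Psi> z = \<Phi> z" if "z \<in> F \<times> {0}" for z
    using that by (auto simp: \<Psi>_def)
  ultimately show ?case by (simp cong: continuous_on_cong)
next
  case (Suc n)
  let ?S = "F \<times> {0..real (Suc n)}"
  have "continuous_on {z \<in> ?S. snd z \<le> real n} \<Psi>"
    by (rule continuous_on_subset[OF Suc]) auto
  moreover have "continuous_on {z \<in> ?S. real n \<le> snd z} (\<lambda>z. \<Phi> ((f ^^ n) (fst z), snd z - real n))"
    by (intro continuous_on_compose2[OF \<Phi>_cont] continuous_intros continuous_on_compose2[OF funpow_cont])
      (auto intro: funpow_F)
  ultimately have "continuous_on ?S (\<lambda>z. if snd z \<le> real n then \<Psi> z else \<Phi> ((f ^^ n) (fst z), snd z - real n))"
    by (intro continuous_on_cases_le continuous_intros) (auto simp: \<Psi>_piece[of _ n "real n"])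
  then show ?case
    by (rule continuous_on_eq) (auto simp: \<Psi>_piece[of _ n])
qed

text \<open>The map \<open>(x, r) \<mapsto> (\<Psi> (x, r), r)\<close> is injective and continuous from a compact space to a Hausdorff space,
  hence an embedding, and its inverse applied to \<open>(H, h)\<close> is the lift.\<close>

lemma lift_exists:
  fixes Q :: "'b::topological_space set"
  assumes H: "continuous_on Q H" "H \<in> Q \<rightarrow> N" and h: "continuous_on Q h" "h \<in> Q \<rightarrow> {0..real M}"
    and pH: "\<And>z. z \<in> Q \<Longrightarrow> p (H z) = cis (2 * pi * h z)"
  obtains K where "continuous_on Q K" "K \<in> Q \<rightarrow> F" "\<And>z. z \<in> Q \<Longrightarrow> \<Psi> (K z, h z) = H z"
proof -
  let ?X = "top_of_set (F \<times> {0..real M})" and ?Y = "prod_topology (top_of_set N) euclideanreal"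
  let ?G = "\<lambda>z. (\<Psi> z, snd z)"
  have \<Psi>N: "\<Psi> z \<in> N" if "z \<in> F \<times> {0..real M}" for z
  proof -
    have "\<Psi> (fst z, snd z) \<in> (\<lambda>x. \<Psi> (x, snd z)) ` F"
      using that by (intro imageI) auto
    then show ?thesis using that by (simp add: \<Psi>_image mem_Times_iff)
  qed
  have "embedding_map ?X ?Y ?G"
  proof (rule continuous_imp_embedding_map)
    show "continuous_map ?X ?Y ?G"
      unfolding continuous_map_pairwise
      using \<Psi>_cont[of M] \<Psi>N by (auto simp: comp_def continuous_map_in_subtopology intro!: continuous_intros)
    show "compact_space ?X"
      using F_compact by (simp add: compact_space_subtopology compact_Times)
    show "Hausdorff_space ?Y"
      using Hausdorff by (simp add: Hausdorff_space_prod_topology)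
    show "inj_on ?G (topspace ?X)"
      by (auto simp: inj_on_def dest: \<Psi>_inj)
  qed
  then obtain g where g: "homeomorphic_maps ?X (subtopology ?Y (?G ` topspace ?X)) ?G g"
    unfolding embedding_map_def homeomorphic_map_maps by blast
  have mem: "(H z, h z) \<in> ?G ` (F \<times> {0..real M})" if "z \<in> Q" for z
  proof -
    have "0 \<le> h z" using h(2) that by auto
    then have "H z \<in> (\<lambda>x. \<Psi> (x, h z)) ` F"
      unfolding \<Psi>_image[OF \<open>0 \<le> h z\<close>] using pH[OF that] H(2) that by auto
    then show ?thesis using h that by force
  qed
  have inv: "g (H z, h z) \<in> F \<times> {0..real M} \<and> \<Psi> (g (H z, h z)) = H z \<and> snd (g (H z, h z)) = h z"
    if z: "z \<in> Q" for z
  proof -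
    obtain w where w: "w \<in> F \<times> {0..real M}" "(H z, h z) = ?G w" using mem[OF z] by auto
    then have "g (H z, h z) = w" using g by (auto simp: homeomorphic_maps_def)
    then show ?thesis using w by auto
  qed
  have "continuous_map (top_of_set Q) (subtopology ?Y (?G ` topspace ?X)) (\<lambda>z. (H z, h z))"
    using H h mem by (auto simp: continuous_map_in_subtopology continuous_map_pairwise comp_def)
  then have "continuous_map (top_of_set Q) ?X (g \<circ> (\<lambda>z. (H z, h z)))"
    by (rule continuous_map_compose) (use g in \<open>unfold homeomorphic_maps_def, blast\<close>)
  then have "continuous_on Q (\<lambda>z. g (H z, h z))"
    by (simp add: continuous_map_in_subtopology comp_def)
  then have "continuous_on Q (\<lambda>z. fst (g (H z, h z)))"
    by (rule continuous_on_fst)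
  moreover have "\<Psi> (fst (g (H z, h z)), h z) = H z" if "z \<in> Q" for z
    using inv[OF that] by (metis prod.collapse)
  ultimately show ?thesis
    using that[of "\<lambda>z. fst (g (H z, h z))"] inv by (auto simp: mem_Times_iff)
qed

lemma fibre_loop_in_loops:
  assumes "g \<in> loops F y" "s \<in> {0..1}"
  shows "(\<lambda>x. \<Phi> (x, s)) \<circ> g \<in> loops N (\<Phi> (y, s))"
proof (rule loops_image[OF assms(1)])
  show "continuous_on F (\<lambda>x. \<Phi> (x, s))"
    by (rule continuous_on_compose2[OF \<Phi>_cont]) (use assms in \<open>auto intro!: continuous_intros\<close>)
  show "(\<lambda>x. \<Phi> (x, s)) \<in> F \<rightarrow> N"
    using \<Phi>_image[OF assms(2)] by blast
qed

text \<open>On the boundary of the square the lift \<open>h\<close> is constantly \<open>s + m\<close>. There the lifted null homotopy \<open>K\<close>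
  is thus the given loop in the coordinates of the \<open>m\<close>-th sheet, and applying \<open>f\<^sup>m\<close> turns \<open>K\<close> into a null
  homotopy of \<open>g\<close> itself.\<close>

proposition fibre_loop_null_homotopic:
  assumes g: "g \<in> loops F y" and s: "s \<in> {0..1}"
    and null: "homotopic_paths N ((\<lambda>x. \<Phi> (x, s)) \<circ> g) (\<lambda>_. \<Phi> (y, s))"
  shows "homotopic_paths F g (\<lambda>_. y)"
proof -
  define Q where "Q = {0..1::real} \<times> {0..1::real}"
  define B where "B = {0,1} \<times> {0..1} \<union> {0..1::real} \<times> {0,1::real}"
  have Q: "convex Q" "compact Q" unfolding Q_def by (auto intro: convex_Times compact_Times)
  have B: "B \<subseteq> Q" "connected B" "B \<noteq> {}"
    using connected_boundary_square by (auto simp: Q_def B_def)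
  have memB: "(0, u) \<in> B" "(1, u) \<in> B" "(u, 0) \<in> B" "(u, 1) \<in> B" if "u \<in> {0..1}" for u
    using that by (auto simp: B_def)
  have g01: "g 0 = y" "g 1 = y" and "g ` {0..1} \<subseteq> F"
    using g by (simp_all add: loops_def path_image_def pathstart_def pathfinish_def)
  then have gF: "\<And>u. u \<in> {0..1} \<Longrightarrow> g u \<in> F" by blast
  from gF[of 0] have y: "y \<in> F" using g01 by simp
  obtain H where H: "continuous_on Q H" "H \<in> Q \<rightarrow> N"
      "\<forall>u\<in>{0..1}. H (0,u) = ((\<lambda>x. \<Phi> (x, s)) \<circ> g) u" "\<forall>u\<in>{0..1}. H (1,u) = \<Phi> (y, s)"
    and ends: "\<forall>t\<in>{0..1}. pathstart (H \<circ> Pair t) = pathstart ((\<lambda>x. \<Phi> (x, s)) \<circ> g) \<and>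
      pathfinish (H \<circ> Pair t) = pathfinish ((\<lambda>x. \<Phi> (x, s)) \<circ> g)"
    using null unfolding homotopic_paths Q_def by blast
  have H0: "H (0,u) = \<Phi> (g u, s)" "H (1,u) = \<Phi> (y, s)" "H (u,0) = \<Phi> (y, s)" "H (u,1) = \<Phi> (y, s)"
    if "u \<in> {0..1}" for u
    using that H(3,4) ends g01 by (auto simp: pathstart_def pathfinish_def)
  have H_B: "\<exists>x\<in>F. H z = \<Phi> (x, s)" if zB: "z \<in> B" for z
  proof -
    obtain t u where z: "z = (t, u)" by (cases z)
    consider "t = 0" "u \<in> {0..1}" | "t = 1" "u \<in> {0..1}" | "u = 0" "t \<in> {0..1}" | "u = 1" "t \<in> {0..1}"
      using zB unfolding z B_def by auto
    then show ?thesis unfolding z by cases (use H0 gF y in metis)+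
  qed
  have p\<Phi>: "p (\<Phi> (x, s)) = cis (2 * pi * s)" if "x \<in> F" for x
    using imageI[OF that, of "\<lambda>x. \<Phi> (x, s)"] unfolding \<Phi>_image[OF s] by simp
  have pH: "continuous_on Q (\<lambda>z. p (H z))"
    using H(2) by (intro continuous_on_compose2[OF p_cont H(1)]) auto
  have pH_circle: "(\<lambda>z. p (H z)) \<in> Q \<rightarrow> circle"
    using H(2) p_circle by blast
  have pH_B: "p (H z) = cis (2 * pi * s)" if "z \<in> B" for z
    using H_B[OF that] p\<Phi> by auto
  obtain h and M m :: nat where h: "continuous_on Q h" "h \<in> Q \<rightarrow> {0..real M}"
      "\<And>z. z \<in> Q \<Longrightarrow> p (H z) = cis (2 * pi * h z)" "\<And>z. z \<in> B \<Longrightarrow> h z = s + real m"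
    by (rule circle_valued_lift_prescribed[OF Q B pH pH_circle pH_B]) (assumption, rule that)
  obtain K where K: "continuous_on Q K" "K \<in> Q \<rightarrow> F" "\<And>z. z \<in> Q \<Longrightarrow> \<Psi> (K z, h z) = H z"
    by (rule lift_exists[OF H(1,2) h(1,2,3)]) (assumption, rule that)
  define L where "L = (\<lambda>z. (f ^^ m) (K z))"
  have LF: "L z \<in> F" if "z \<in> Q" for z
    using K(2) that funpow_F by (auto simp: L_def)
  have L: "L z = x" if "z \<in> B" "H z = \<Phi> (x, s)" "x \<in> F" for z x
  proof -
    have z: "z \<in> Q" using that(1) B(1) by blast
    have "\<Psi> (K z, h z) = \<Phi> (L z, h z - real m)"
      unfolding L_def using K(2) z s h(4)[OF that(1)] by (intro \<Psi>_piece) auto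
    then have "\<Phi> (L z, s) = \<Phi> (x, s)"
      using K(3)[OF z] h(4)[OF that(1)] that(2) by simp
    then show ?thesis using \<Phi>_inj[OF s LF[OF z] that(3)] by simp
  qed
  have L_cont: "continuous_on Q L"
    unfolding L_def
  proof (rule continuous_on_compose2[OF funpow_cont K(1)])
    show "K ` Q \<subseteq> F" using K(2) by blast
  qed
  have L_F: "L \<in> Q \<rightarrow> F" using LF by blast
  have L_ends: "L (0,u) = g u" "L (1,u) = y" "L (u,0) = y" "L (u,1) = y" if u: "u \<in> {0..1}" for u
    using L[OF memB(1)[OF u] H0(1)[OF u] gF[OF u]] L[OF memB(2)[OF u] H0(2)[OF u] y]
      L[OF memB(3)[OF u] H0(3)[OF u] y] L[OF memB(4)[OF u] H0(4)[OF u] y] by simp_all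
  show ?thesis
    unfolding homotopic_paths Q_def[symmetric]
  proof (intro exI[of _ L] conjI ballI)
    fix t :: real assume t: "t \<in> {0..1}"
    show "L (0, t) = g t" "L (1, t) = y" using L_ends(1,2)[OF t] .
    show "pathstart (L \<circ> Pair t) = pathstart g" "pathfinish (L \<circ> Pair t) = pathfinish g"
      using L_ends(3,4)[OF t] g01 by (simp_all add: pathstart_def pathfinish_def)
  qed (rule L_cont L_F)+
qed

end

section \<open>Conjugation by a section loop is the monodromy\<close>

lemma nonzero_torus_winding:
  assumes "y \<in> torus"
  obtains g where "g \<in> loops torus y" "torus_winding g \<noteq> 0"
proof
  let ?q = "\<lambda>u::real. Ln (fst y) + 2 * of_real pi * \<i> * of_real u"
  let ?g = "\<lambda>u. (exp (?q u), snd y)"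
  have y: "norm (fst y) = 1" "norm (snd y) = 1" using assms by auto
  then have nz: "fst y \<noteq> 0" by auto
  have q: "path ?q" unfolding path_def by (intro continuous_intros)
  have ends: "exp (?q 0) = fst y" "exp (?q 1) = fst y"
    using nz by (simp_all add: exp_add)
  have norm1: "norm (exp (?q u)) = 1" for u
    using y nz by (simp add: exp_add norm_mult)
  have "path ?g" unfolding path_def by (intro continuous_intros)
  then show "?g \<in> loops torus y"
    using ends norm1 y by (auto simp: loops_def path_image_def pathstart_def pathfinish_def)
  have "winding_number (exp \<circ> ?q) 0 = 1"
    using winding_number_compose_exp[OF q] by (simp add: pathstart_def pathfinish_def)
  moreover have "fst \<circ> ?g = exp \<circ> ?q" by auto
  ultimately show "torus_winding ?g \<noteq> 0"
    by (simp add: torus_winding_def zero_prod_def)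
qed

text \<open>The monodromy need not fix a point. Group translations of the torus, along a path from \<open>y\<close> to \<open>y'\<close>,
  move the base point without changing homotopy classes of loops.\<close>

lemma torus_path_of_translations:
  assumes "y \<in> torus" "y' \<in> torus"
  obtains M :: "real \<times> (complex \<times> complex) \<Rightarrow> complex \<times> complex"
  where "continuous_on ({0..1} \<times> torus) M" "M \<in> {0..1} \<times> torus \<rightarrow> torus"
    "\<forall>x. M (0, x) = x" "M (1, y) = y'"
proof -
  have "path_connected circle" by (rule path_connected_sphere) simp
  then have "path_connected torus" by (intro path_connected_Times)
  then obtain c where c: "path c" "path_image c \<subseteq> torus" "pathstart c = y" "pathfinish c = y'"
    using assms unfolding path_connected_def by blast
  have c_cont: "continuous_on {0..1} c" using c(1) by (simp add: path_def)
  have cT: "c t \<in> torus" if "t \<in> {0..1}" for t using c(2) that by (auto simp: path_image_def)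
  have c01: "c 0 = y" "c 1 = y'" using c by (simp_all add: pathstart_def pathfinish_def)
  have y: "norm (fst y) = 1" "norm (snd y) = 1" "fst y \<noteq> 0" "snd y \<noteq> 0" using assms(1) by auto
  show ?thesis
  proof
    let ?M = "\<lambda>z. (fst (c (fst z)) / fst y * fst (snd z), snd (c (fst z)) / snd y * snd (snd z))"
    have "continuous_on ({0..1} \<times> torus) (\<lambda>z. c (fst z))"
      by (intro continuous_on_compose2[OF c_cont] continuous_intros) auto
    then show "continuous_on ({0..1} \<times> torus) ?M"
      using y by (intro continuous_intros) auto
    show "?M \<in> {0..1} \<times> torus \<rightarrow> torus"
    proof
      fix z assume z: "z \<in> {0..1::real} \<times> torus"
      then have "norm (fst (c (fst z))) = 1" "norm (snd (c (fst z))) = 1"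
        using cT[of "fst z"] by (auto simp: mem_Times_iff)
      then show "?M z \<in> torus"
        using y z by (auto simp: norm_mult norm_divide)
    qed
    show "\<forall>x. ?M (0, x) = x" using y c01 by simp
    show "?M (1, y) = y'" using y c01 by simp
  qed
qed

text \<open>The homotopy \<open>M\<close> prepares the loop so that, after one turn around the circle and an application of \<open>f\<close>,
  it is again based at \<open>y\<close>. The square \<open>(t, u) \<mapsto> \<Psi> (M (t, g u), s + t)\<close> starts with \<open>g\<close> in the fibre over
  \<open>s\<close>, ends with its image under the monodromy in the same fibre, and has the loop \<open>\<sigma>\<close> on both
  remaining sides.\<close>

lemma (in monodromy_trivialisation) monodromy_conjugation:
  assumes s: "s \<in> {0..1}" and M: "continuous_on ({0..1} \<times> F) M" "M \<in> {0..1} \<times> F \<rightarrow> F"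
    "\<And>x. x \<in> F \<Longrightarrow> M (0, x) = x" and y: "y \<in> F" "f (M (1, y)) = y"
  defines "\<sigma> \<equiv> \<lambda>t. \<Psi> (M (t, y), s + t)"
  shows "\<sigma> \<in> loops N (\<Phi> (y, s))"
    and "g \<in> loops F y \<Longrightarrow>
      homotopic_paths N (((\<lambda>x. \<Phi> (x, s)) \<circ> g) +++ \<sigma>) (\<sigma> +++ ((\<lambda>x. \<Phi> (x, s)) \<circ> (\<lambda>u. f (M (1, g u)))))"
proof -
  have MF: "M (t, x) \<in> F" if "t \<in> {0..1}" "x \<in> F" for t x
    using M(2) that by auto
  have start: "\<Psi> (M (0, x), s + 0) = \<Phi> (x, s)" if "x \<in> F" for x
    using \<Psi>_piece[of x 0 s] s that M(3) by simp
  have finish: "\<Psi> (M (1, x), s + 1) = \<Phi> (f (M (1, x)), s)" if "x \<in> F" for x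
    using \<Psi>_piece[of "M (1, x)" 1 "s + 1"] s MF[of 1 x] that by simp
  have K_cont: "continuous_on ({0..1} \<times> {0..1}) (\<lambda>z. \<Psi> (M (fst z, g (snd z)), s + fst z))"
    and K_N: "(\<lambda>z. \<Psi> (M (fst z, g (snd z)), s + fst z)) \<in> {0..1} \<times> {0..1} \<rightarrow> N"
    if g: "continuous_on {0..1} g" "\<And>u. u \<in> {0..1} \<Longrightarrow> g u \<in> F" for g :: "real \<Rightarrow> 'c"
  proof -
    have "continuous_on ({0..1::real} \<times> {0..1}) (\<lambda>z. g (snd z))"
      by (rule continuous_on_compose2[OF g(1)]) (auto intro!: continuous_intros)
    then have "continuous_on ({0..1} \<times> {0..1}) (\<lambda>z. M (fst z, g (snd z)))"
      using g(2) by (intro continuous_on_compose2[OF M(1)] continuous_intros) auto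
    then have "continuous_on ({0..1} \<times> {0..1}) (\<lambda>z. (M (fst z, g (snd z)), s + fst z))"
      by (intro continuous_intros)
    then show "continuous_on ({0..1} \<times> {0..1}) (\<lambda>z. \<Psi> (M (fst z, g (snd z)), s + fst z))"
    proof (rule continuous_on_compose2[OF \<Psi>_cont[of 2]])
      show "(\<lambda>z. (M (fst z, g (snd z)), s + fst z)) ` ({0..1} \<times> {0..1}) \<subseteq> F \<times> {0..real 2}"
        using MF g(2) s by force
    qed
    show "(\<lambda>z. \<Psi> (M (fst z, g (snd z)), s + fst z)) \<in> {0..1} \<times> {0..1} \<rightarrow> N"
    proof
      fix z assume z: "z \<in> {0..1::real} \<times> {0..1::real}"
      then have "M (fst z, g (snd z)) \<in> F" "0 \<le> s + fst z" using MF g(2) s by auto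
      then show "\<Psi> (M (fst z, g (snd z)), s + fst z) \<in> N"
        using \<Psi>_image[of "s + fst z"] by blast
    qed
  qed
  have t0: "continuous_on {0..1} (\<lambda>t::real. (t, 0::real))"
    by (intro continuous_intros)
  have "continuous_on ({0..1} \<times> {0..1::real}) (\<lambda>z. \<Psi> (M (fst z, y), s + fst z))"
    using K_cont[of "\<lambda>_. y"] y(1) by simp
  from continuous_on_compose2[OF this t0]
  have "continuous_on {0..1} (\<lambda>t. \<Psi> (M (t, y), s + t))"
    by (simp add: image_subset_iff)
  moreover have "\<Psi> (M (t, y), s + t) \<in> N" if "t \<in> {0..1}" for t
    using funcset_mem[OF K_N[of "\<lambda>_. y"], of "(t, 0)"] y(1) that by auto
  ultimately show "\<sigma> \<in> loops N (\<Phi> (y, s))"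
    using start[OF y(1)] finish[OF y(1)] y(2)
    by (auto simp: \<sigma>_def loops_def path_def path_image_def pathstart_def pathfinish_def)
  assume g: "g \<in> loops F y"
  then have gc: "continuous_on {0..1} g" and gF: "\<And>u. u \<in> {0..1} \<Longrightarrow> g u \<in> F" and g01: "g 0 = y" "g 1 = y"
    by (simp_all add: loops_def path_def path_image_def pathstart_def pathfinish_def image_subset_iff)
  let ?K = "\<lambda>z. \<Psi> (M (fst z, g (snd z)), s + fst z)"
  have sq: "homotopic_paths N ((\<lambda>u. ?K (0, u)) +++ (\<lambda>t. ?K (t, 1))) ((\<lambda>t. ?K (t, 0)) +++ (\<lambda>u. ?K (1, u)))"
    by (rule homotopic_paths_square[OF K_cont[OF gc gF] K_N[OF gc gF]])
  have \<sigma>_eq: "(\<lambda>t. ?K (t, 1)) = \<sigma>" "(\<lambda>t. ?K (t, 0)) = \<sigma>"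
    by (simp_all add: \<sigma>_def g01)
  have "(\<lambda>u. ?K (0, u)) u = ((\<lambda>x. \<Phi> (x, s)) \<circ> g) u" 
    "(\<lambda>u. ?K (1, u)) u = ((\<lambda>x. \<Phi> (x, s)) \<circ> (\<lambda>u. f (M (1, g u)))) u" if "u \<in> {0..1}" for u
    using start[OF gF[OF that]] finish[OF gF[OF that]] by (simp_all)
  then have "((\<lambda>u. ?K (0, u)) +++ \<sigma>) t = (((\<lambda>x. \<Phi> (x, s)) \<circ> g) +++ \<sigma>) t"
     "(\<sigma> +++ (\<lambda>u. ?K (1, u))) t = (\<sigma> +++ ((\<lambda>x. \<Phi> (x, s)) \<circ> (\<lambda>u. f (M (1, g u))))) t"
    if "t \<in> {0..1}" for t
    using that by (simp_all add: joinpaths_def)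
  moreover have sq': "homotopic_paths N ((\<lambda>u. ?K (0, u)) +++ \<sigma>) (\<sigma> +++ (\<lambda>u. ?K (1, u)))"
    using sq unfolding \<sigma>_eq .
  ultimately show "homotopic_paths N (((\<lambda>x. \<Phi> (x, s)) \<circ> g) +++ \<sigma>) (\<sigma> +++ ((\<lambda>x. \<Phi> (x, s)) \<circ> (\<lambda>u. f (M (1, g u)))))"
    by (intro homotopic_paths_eq_cong[OF sq'])
qed

section \<open>The Sol relations in the fundamental group\<close>

text \<open>The relations are first relations between winding numbers in the fibre, transported by the map \<open>\<iota>\<close> that
  includes the fibre through \<open>x0\<close>. The translations hidden in \<open>T\<close> are homotopic to the identity, so that
  \<open>T\<close> has the same effect on winding numbers as composition with \<open>f\<close>.\<close>

lemma fundamental_group_fibre_relations: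
  fixes N :: "'a::topological_space set"
  assumes mono: "monodromy_trivialisation N p torus \<Phi> f" and x0: "x0 \<in> N"
    and rec: "\<forall>y. \<forall>g\<in>loops torus y.
      torus_winding (f \<circ> (f \<circ> g)) + torus_winding g = real n *\<^sub>R torus_winding (f \<circ> g)"
  obtains a b c s where
    "a \<in> carrier (fundamental_group N x0)" "b \<in> carrier (fundamental_group N x0)"
    "c \<in> carrier (fundamental_group N x0)" "s \<in> carrier (fundamental_group N x0)"
    "a \<otimes>\<^bsub>fundamental_group N x0\<^esub> b = b \<otimes>\<^bsub>fundamental_group N x0\<^esub> a"
    "a \<otimes>\<^bsub>fundamental_group N x0\<^esub> s = s \<otimes>\<^bsub>fundamental_group N x0\<^esub> b"
    "b \<otimes>\<^bsub>fundamental_group N x0\<^esub> s = s \<otimes>\<^bsub>fundamental_group N x0\<^esub> c"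
    "c \<otimes>\<^bsub>fundamental_group N x0\<^esub> a = b [^]\<^bsub>fundamental_group N x0\<^esub> n"
    "\<forall>k::nat. k > 0 \<longrightarrow> a [^]\<^bsub>fundamental_group N x0\<^esub> k \<noteq> \<one>\<^bsub>fundamental_group N x0\<^esub>"
proof -
  interpret monodromy_trivialisation N p torus \<Phi> f by (fact mono)
  let ?G = "fundamental_group N x0"
  have "norm (p x0) = 1" using p_circle x0 by auto
  define s0 where "s0 = Arg2pi (p x0) / (2 * pi)"
  have s0: "s0 \<in> {0..1}"
    using Arg2pi_ge_0[of "p x0"] Arg2pi_lt_2pi[of "p x0"] by (auto simp: s0_def)
  have "p x0 = cis (2 * pi * s0)"
    using Arg2pi_eq[of "p x0"] \<open>norm (p x0) = 1\<close> by (simp add: s0_def cis_conv_exp)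
  then have "x0 \<in> (\<lambda>x. \<Phi> (x, s0)) ` torus" unfolding \<Phi>_image[OF s0] using x0 by simp
  then obtain y where y: "y \<in> torus" "x0 = \<Phi> (y, s0)" by blast
  have "y \<in> f ` torus" using bij_betw_imp_surj_on[OF f_bij] y(1) by simp
  then obtain y' where y': "y' \<in> torus" "f y' = y" by (elim imageE) metis
  obtain M :: "real \<times> (complex \<times> complex) \<Rightarrow> complex \<times> complex"
    where M: "continuous_on ({0..1} \<times> torus) M" "M \<in> {0..1} \<times> torus \<rightarrow> torus"
    "\<forall>x. M (0, x) = x" "M (1, y) = y'"
    using torus_path_of_translations[OF y(1) y'(1)] .
  have M0: "M (0, x) = x" for x using M(3) by blast
  define \<sigma> where "\<sigma> = (\<lambda>t. \<Psi> (M (t, y), s0 + t))"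
  define \<iota> where "\<iota> = (\<lambda>g. (\<lambda>x. \<Phi> (x, s0)) \<circ> (g :: real \<Rightarrow> complex \<times> complex))"
  define T where "T = (\<lambda>g (u::real). f (M (1, g u)))"
  have fM: "f (M (1, y)) = y" using M(4) y'(2) by simp
  have \<sigma>: "\<sigma> \<in> loops N x0"
    unfolding \<sigma>_def y(2) by (rule monodromy_conjugation(1)[OF s0 M(1,2) M0 y(1) fM])
  have \<iota>: "\<iota> g \<in> loops N x0" if "g \<in> loops torus y" for g
    unfolding \<iota>_def y(2) by (rule fibre_loop_in_loops[OF that s0])
  have conj: "homotopic_paths N (\<iota> g +++ \<sigma>) (\<sigma> +++ \<iota> (T g))" if "g \<in> loops torus y" for g
    unfolding \<sigma>_def \<iota>_def T_def by (rule monodromy_conjugation(2)[OF s0 M(1,2) M0 y(1) fM that])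
  have M1: "continuous_on torus (\<lambda>x. M (1, x))"
    by (rule continuous_on_compose2[OF M(1)]) (auto intro!: continuous_intros)
  have M1T: "(\<lambda>x. M (1, x)) \<in> torus \<rightarrow> torus"
  proof
    fix x :: "complex \<times> complex" assume x: "x \<in> torus"
    have "(1::real, x) \<in> {0..1} \<times> torus" by (rule SigmaI) (simp, rule x)
    with M(2) show "M (1, x) \<in> torus" by (rule funcset_mem)
  qed
  have T_eq: "T g = f \<circ> ((\<lambda>x. M (1, x)) \<circ> g)" for g by (auto simp: T_def)
  have M1_loops: "(\<lambda>x. M (1, x)) \<circ> g \<in> loops torus y'" if "g \<in> loops torus y" for g
    using loops_image[OF that M1 M1T] unfolding M(4) .
  have T_loops: "T g \<in> loops torus y" if "g \<in> loops torus y" for g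
    using loops_image[OF M1_loops[OF that] f_cont f_F] y'(2) by (simp add: T_eq)
  have hom: "homotopic_loops torus g ((\<lambda>x. M (1, x)) \<circ> g)" if g: "g \<in> loops torus y" for g
    unfolding homotopic_loops
  proof (intro exI[of _ "\<lambda>z. M (fst z, g (snd z))"] conjI ballI)
    have gT: "g u \<in> torus" if "u \<in> {0..1}" for u
      using g that by (auto simp: loops_def path_image_def)
    have gc: "continuous_on {0..1} g" using g by (simp add: loops_def path_def)
    have "continuous_on ({0..1::real} \<times> {0..1}) (\<lambda>z. g (snd z))"
      by (rule continuous_on_compose2[OF gc]) (auto intro!: continuous_intros)
    then have "continuous_on ({0..1::real} \<times> {0..1}) (\<lambda>z. (fst z, g (snd z)))"
      by (intro continuous_intros)
    then show "continuous_on ({0..1} \<times> {0..1}) (\<lambda>z. M (fst z, g (snd z)))"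
    proof (rule continuous_on_compose2[OF M(1)])
      show "(\<lambda>z. (fst z, g (snd z))) ` ({0..1} \<times> {0..1}) \<subseteq> {0..1} \<times> torus"
        using gT by (simp add: image_subset_iff mem_Times_iff)
    qed
    show "(\<lambda>z. M (fst z, g (snd z))) \<in> {0..1} \<times> {0..1} \<rightarrow> torus"
    proof
      fix z assume "z \<in> {0..1::real} \<times> {0..1::real}"
      then have "(fst z, g (snd z)) \<in> {0..1} \<times> torus" using gT by (simp add: mem_Times_iff)
      with M(2) show "M (fst z, g (snd z)) \<in> torus" by (rule funcset_mem)
    qed
    have "g 0 = g 1" using g by (simp add: loops_def pathstart_def pathfinish_def)
    then show "pathfinish ((\<lambda>z. M (fst z, g (snd z))) \<circ> Pair t) = pathstart ((\<lambda>z. M (fst z, g (snd z))) \<circ> Pair t)" for t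
      by (simp add: pathstart_def pathfinish_def)
  qed (simp_all add: M0)
  have tw_T: "torus_winding (T g) = torus_winding (f \<circ> g)" if "g \<in> loops torus y" for g
    using homotopic_loops_torus_winding[OF homotopic_loops_continuous_image[OF hom[OF that] f_cont f_F]]
    by (simp add: T_eq)
  have tw_TT: "torus_winding (T (T g)) = torus_winding (f \<circ> (f \<circ> g))" if "g \<in> loops torus y" for g
    using tw_T[OF T_loops[OF that]]
      homotopic_loops_torus_winding[OF homotopic_loops_continuous_image[OF
        homotopic_loops_continuous_image[OF hom[OF that] f_cont f_F] f_cont f_F]]
    by (simp add: T_eq)
  have \<iota>_class: "loop_class N (\<iota> g) = loop_class N (\<iota> h)"
    if "g \<in> loops torus y" "h \<in> loops torus y" "torus_winding g = torus_winding h" for g h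
  proof -
    have "homotopic_paths torus g h" using homotopic_paths_torus_iff that by blast
    moreover have "continuous_on torus (\<lambda>x. \<Phi> (x, s0))"
      by (rule continuous_on_compose2[OF \<Phi>_cont]) (use s0 in \<open>auto intro!: continuous_intros\<close>)
    moreover have "(\<lambda>x. \<Phi> (x, s0)) \<in> torus \<rightarrow> N" using \<Phi>_image[OF s0] by blast
    ultimately show ?thesis unfolding \<iota>_def
      by (intro loop_class_eqI homotopic_paths_continuous_image)
  qed
  have \<iota>_mult: "loop_class N (\<iota> g) \<otimes>\<^bsub>?G\<^esub> loop_class N (\<iota> h) = loop_class N (\<iota> (g +++ h))"
    if "g \<in> loops torus y" "h \<in> loops torus y" for g h
    unfolding fundamental_group_mult[OF \<iota>[OF that(1)] \<iota>[OF that(2)]] by (simp add: \<iota>_def path_compose_join)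
  have \<iota>_pow: "loop_class N (\<iota> g) [^]\<^bsub>?G\<^esub> k = loop_class N (\<iota> (loop_pow g k))"
    if "g \<in> loops torus y" for g and k :: nat
    unfolding loop_class_pow[OF \<iota>[OF that]] by (simp add: \<iota>_def loop_pow_compose)
  have carr: "loop_class N g \<in> carrier ?G" if "g \<in> loops N x0" for g
    using that by (simp add: fundamental_group_def)
  have \<sigma>_conj: "loop_class N (\<iota> g) \<otimes>\<^bsub>?G\<^esub> loop_class N \<sigma> = loop_class N \<sigma> \<otimes>\<^bsub>?G\<^esub> loop_class N (\<iota> (T g))"
    if "g \<in> loops torus y" for g
    unfolding fundamental_group_mult[OF \<iota>[OF that] \<sigma>] fundamental_group_mult[OF \<sigma> \<iota>[OF T_loops[OF that]]]
    by (rule loop_class_eqI[OF conj[OF that]])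
  obtain g where g: "g \<in> loops torus y" "torus_winding g \<noteq> 0"
    using nonzero_torus_winding[OF y(1)] .
  note Tg = T_loops[OF g(1)] and TTg = T_loops[OF T_loops[OF g(1)]]
  show ?thesis
  proof (rule that)
    show "loop_class N (\<iota> g) \<otimes>\<^bsub>?G\<^esub> loop_class N (\<iota> (T g)) = loop_class N (\<iota> (T g)) \<otimes>\<^bsub>?G\<^esub> loop_class N (\<iota> g)"
      unfolding \<iota>_mult[OF g(1) Tg] \<iota>_mult[OF Tg g(1)]
      by (rule \<iota>_class) (simp_all add: join_in_loops g Tg torus_winding_join[OF g(1) Tg] torus_winding_join[OF Tg g(1)] add.commute)
    show "loop_class N (\<iota> g) \<otimes>\<^bsub>?G\<^esub> loop_class N \<sigma> = loop_class N \<sigma> \<otimes>\<^bsub>?G\<^esub> loop_class N (\<iota> (T g))"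
      "loop_class N (\<iota> (T g)) \<otimes>\<^bsub>?G\<^esub> loop_class N \<sigma> = loop_class N \<sigma> \<otimes>\<^bsub>?G\<^esub> loop_class N (\<iota> (T (T g)))"
      using \<sigma>_conj[OF g(1)] \<sigma>_conj[OF Tg] .
    show "loop_class N (\<iota> (T (T g))) \<otimes>\<^bsub>?G\<^esub> loop_class N (\<iota> g) = loop_class N (\<iota> (T g)) [^]\<^bsub>?G\<^esub> n"
      unfolding \<iota>_mult[OF TTg g(1)] \<iota>_pow[OF Tg]
      by (rule \<iota>_class)
        (simp_all add: join_in_loops g TTg loop_pow_in_loops Tg torus_winding_join[OF TTg g(1)]
          torus_winding_pow[OF Tg] tw_T[OF g(1)] tw_TT[OF g(1)] rec[rule_format, OF g(1)])
    show "\<forall>k::nat. k > 0 \<longrightarrow> loop_class N (\<iota> g) [^]\<^bsub>?G\<^esub> k \<noteq> \<one>\<^bsub>?G\<^esub>"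
    proof (intro allI impI notI)
      fix k :: nat assume k: "k > 0"
      assume "loop_class N (\<iota> g) [^]\<^bsub>?G\<^esub> k = \<one>\<^bsub>?G\<^esub>"
      then have "loop_class N (\<iota> (loop_pow g k)) = loop_class N (\<lambda>_. x0)"
        unfolding \<iota>_pow[OF g(1)] by (simp add: fundamental_group_def)
      then have "homotopic_paths N (\<iota> (loop_pow g k)) (\<lambda>_. x0)"
        using loop_class_eq_iff[OF \<iota>[OF loop_pow_in_loops[OF g(1)]]] by blast
      then have "homotopic_paths torus (loop_pow g k) (\<lambda>_. y)"
        unfolding \<iota>_def y(2) by (rule fibre_loop_null_homotopic[OF loop_pow_in_loops[OF g(1)] s0])
      then have "torus_winding (loop_pow g k) = 0"
        using homotopic_paths_torus_iff[OF loop_pow_in_loops[OF g(1)] const_in_loops[OF y(1)]]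
          torus_winding_const[OF y(1)] by simp
      then show False using g(2) k by (simp add: torus_winding_pow[OF g(1)])
    qed
  qed (simp_all add: carr \<iota> \<sigma> g(1) Tg TTg)
qed

theorem proposition1p3:
  fixes N :: "'a::topological_space set" and x0 :: 'a
  assumes "sol_torus_bundle N" and "x0 \<in> N"
  shows "\<not> (\<exists>H. subgroup H (fundamental_group N x0) \<and>
              finite (rcosets\<^bsub>fundamental_group N x0\<^esub> H) \<and>
              (\<forall>p. prime p \<longrightarrow> residually_p p ((fundamental_group N x0)\<lparr>carrier := H\<rparr>)))"
proof -
  obtain p f e A t where
      N: "closed_manifold 3 (top_of_set N)" and fib: "fibre_bundle N p circle torus"
    and f: "is_monodromy N p torus f"
    and e: "is_Z_basis (homology_group 1 (top_of_set torus)) (e :: 2 \<Rightarrow> (complex \<times> complex) chain set)"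
    and A: "represents (homology_group 1 (top_of_set torus)) e
             (hom_induced 1 (top_of_set torus) {} (top_of_set torus) {} f) A"
    and t: "(t::real) > 0" "eigenvalues A = {complex_of_real (exp (- t)), complex_of_real (exp t)}"
    using assms(1) unfolding sol_torus_bundle_def by blast
  obtain \<Phi> where \<Phi>: "continuous_on (torus \<times> {0..1}) \<Phi>"
      "\<forall>s\<in>{0..1}. \<exists>k. homeomorphism torus (N \<inter> p -` {cis (2 * pi * s)}) (\<lambda>x. \<Phi> (x, s)) k"
      "f \<in> torus \<rightarrow> torus" "\<forall>x\<in>torus. \<Phi> (f x, 0) = \<Phi> (x, 1)"
    using f unfolding is_monodromy_def by blast
  have mono: "monodromy_trivialisation N p torus \<Phi> f"
  proof
    show "Hausdorff_space (top_of_set N)" using N by (simp add: closed_manifold_def)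
    show "continuous_on N p" "p \<in> N \<rightarrow> circle" using fib by (auto simp: fibre_bundle_def)
    show "compact torus" by (intro compact_Times compact_sphere)
  qed (use \<Phi> in blast)+
  obtain n :: nat where n: "n > 2"
    and rec: "\<forall>y. \<forall>g\<in>loops torus y.
      torus_winding (f \<circ> (f \<circ> g)) + torus_winding g = real n *\<^sub>R torus_winding (f \<circ> g)"
    using torus_winding_recurrence[OF monodromy_trivialisation.f_cont[OF mono] \<Phi>(3) e A t] .
  interpret G: group "fundamental_group N x0"
    using assms(2) by (rule group_fundamental_group)
  obtain a b c s where rel:
    "a \<in> carrier (fundamental_group N x0)" "b \<in> carrier (fundamental_group N x0)"
    "c \<in> carrier (fundamental_group N x0)" "s \<in> carrier (fundamental_group N x0)"
    "a \<otimes>\<^bsub>fundamental_group N x0\<^esub> b = b \<otimes>\<^bsub>fundamental_group N x0\<^esub> a"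
    "a \<otimes>\<^bsub>fundamental_group N x0\<^esub> s = s \<otimes>\<^bsub>fundamental_group N x0\<^esub> b"
    "b \<otimes>\<^bsub>fundamental_group N x0\<^esub> s = s \<otimes>\<^bsub>fundamental_group N x0\<^esub> c"
    "c \<otimes>\<^bsub>fundamental_group N x0\<^esub> a = b [^]\<^bsub>fundamental_group N x0\<^esub> n"
    "\<forall>k::nat. k > 0 \<longrightarrow> a [^]\<^bsub>fundamental_group N x0\<^esub> k \<noteq> \<one>\<^bsub>fundamental_group N x0\<^esub>"
    using fundamental_group_fibre_relations[OF mono assms(2) rec] .
  show ?thesis
    using G.not_residually_p_of_hyperbolic_conjugation[OF _ _ rel(1-8) n rel(9)[rule_format]] by blast
qed

end
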